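(* Let $\mathcal{I}$ be a meager ideal on $\mathbf{N}$ and let $A=(a_{n,i})$ be a regular matrix such that $\lim_n\sum_i|a_{n,i}|=1$. Then the set $$\{x\in(0,1]: \Gamma_b^k(x,\mathcal{I},A)=\Delta_b^k \text{ for all integers } b\ge2,\ k\ge1\}$$ is comeager in $(0,1]$.
   Context: For an integer $b\ge 2$ and $x\in(0,1]$, write $x=\sum_{n\ge 1} d_{b,n}(x)/b^n$ for the unique nonterminating $b$-adic expansion, with digits $d_{b,n}(x)\in\{0,\dots,b-1\}$. Let $S_b^k$ be the set of strings $\bm{s}=s_1\cdots s_k$ of length $k$ over $\{0,\dots,b-1\}$. For $\bm{s}\in S_b^k$ and $n\ge1$ put $\pi_{b,\bm{s},n}(x)=\frac{1}{n}\#\{i\in\{1,\dots,n\}: d_{b,i+j-1}(x)=s_j \text{ for all } j=1,\dots,k\}$, and $\bm{\pi}^k_{b,n}(x)=(\pi_{b,\bm{s},n}(x):\bm{s}\in S_b^k)\in\mathbf{R}^{b^k}$. Let $\Delta_b^k=\{(p_{\bm{s}})_{\bm{s}\in S_b^k}\in\mathbf{R}^{b^k}: \sum_{\bm{s}}p_{\bm{s}}=1,\ p_{\bm{s}}\ge0,\ \sum_{s_0}p_{s_0\bm{s}}=\sum_{s_k}p_{\bm{s}s_k} \text{ for all } \bm{s}\in S_b^{k-1}\}$ (concatenated strings). An ideal on $\mathbf{N}$ is a family $\mathcal{I}\subseteq\mathcal{P}(\mathbf{N})$ closed under finite unions and subsets, containing all finite sets, and $\ne\mathcal{P}(\mathbf{N})$;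 it is meager if it is a meager subset of $\mathcal{P}(\mathbf{N})$ with the Cantor-space topology. A regular matrix is an infinite real matrix $A=(a_{n,i})_{n,i\in\mathbf{N}}$ such that for every $d$ and every $\mathbf{R}^d$-valued sequence $\bm{z}=(\bm{z}_i)$ converging to $\bm{\eta}$, the series $A_n\bm{z}:=\sum_i a_{n,i}\bm{z}_i$ exists for all $n$ and $\lim_n A_n\bm{z}=\bm{\eta}$. For a sequence $(x_n)$ in $\mathbf{R}^d$, $\eta$ is an $\mathcal{I}$-cluster point if $\{n: x_n\in U\}\notin\mathcal{I}$ for every open neighborhood $U$ of $\eta$. With $\bm{\pi}^k_b(x)=(\bm{\pi}^k_{b,n}(x):n\ge1)$, $\Gamma_b^k(x,\mathcal{I},A)$ denotes the set of $\mathcal{I}$-cluster points of $(A_n\bm{\pi}^k_b(x):n\ge1)$. *)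

theory Defs
  imports "HOL-Analysis.Analysis"
begin

definition nowhere_dense_in :: "'a topology \<Rightarrow> 'a set \<Rightarrow> bool" where
  "nowhere_dense_in X S \<longleftrightarrow> S \<subseteq> topspace X \<and> X interior_of (X closure_of S) = {}"

definition meager_in :: "'a topology \<Rightarrow> 'a set \<Rightarrow> bool" where
  "meager_in X S \<longleftrightarrow> (\<exists>F :: nat \<Rightarrow> 'a set. (\<forall>n. nowhere_dense_in X (F n)) \<and> S \<subseteq> (\<Union>n. F n))"

definition comeager_in :: "'a topology \<Rightarrow> 'a set \<Rightarrow> bool" where
  "comeager_in X S \<longleftrightarrow> S \<subseteq> topspace X \<and> meager_in X (topspace X - S)"

text \<open>N is represented by the Isabelle type nat (index shift n \<mapsto> n-1).\<close>

definition is_ideal :: "nat set set \<Rightarrow> bool" where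
  "is_ideal I \<longleftrightarrow>
     (\<forall>A\<in>I. \<forall>B\<in>I. A \<union> B \<in> I) \<and>
     (\<forall>A\<in>I. \<forall>B. B \<subseteq> A \<longrightarrow> B \<in> I) \<and>
     (\<forall>A. finite A \<longrightarrow> A \<in> I) \<and>
     I \<noteq> UNIV"

text \<open>Cantor space: P(N) identified with nat \<Rightarrow> bool (characteristic functions),
  carrying the product of discrete topologies.\<close>

definition cantor_topology :: "(nat \<Rightarrow> bool) topology" where
  "cantor_topology = product_topology (\<lambda>_. discrete_topology UNIV) UNIV"

definition meager_ideal :: "nat set set \<Rightarrow> bool" where
  "meager_ideal I \<longleftrightarrow> is_ideal I \<and> meager_in cantor_topology ((\<lambda>A n. n \<in> A) ` I)"

text \<open>A matrix a (rows n, columns i; index shift as above). Regularity for R^d-valued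
  sequences is equivalent to regularity for real sequences (componentwise).\<close>

definition regular_matrix :: "(nat \<Rightarrow> nat \<Rightarrow> real) \<Rightarrow> bool" where
  "regular_matrix a \<longleftrightarrow>
     (\<forall>z :: nat \<Rightarrow> real. \<forall>\<eta>. z \<longlonglongrightarrow> \<eta> \<longrightarrow>
        (\<forall>n. summable (\<lambda>i. a n i * z i)) \<and> (\<lambda>n. \<Sum>i. a n i * z i) \<longlonglongrightarrow> \<eta>)"

text \<open>digit b x n = d_{b,n}(x) for n \<ge> 1 (value at 0 fixed to 0 for uniqueness).\<close>

definition digit :: "nat \<Rightarrow> real \<Rightarrow> nat \<Rightarrow> nat" where
  "digit b x = (THE d :: nat \<Rightarrow> nat. d 0 = 0 \<and> (\<forall>n. d n < b) \<and>
      (\<lambda>n. real (d (Suc n)) / real b ^ Suc n) sums x \<and>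
      (\<forall>m. \<exists>n>m. d n \<noteq> 0))"

text \<open>Vectors in R^{b^k} are functions nat list \<Rightarrow> real vanishing outside S_b^k.\<close>

definition strings :: "nat \<Rightarrow> nat \<Rightarrow> nat list set" where
  "strings b k = {s. length s = k \<and> (\<forall>c\<in>set s. c < b)}"

definition freq :: "nat \<Rightarrow> nat list \<Rightarrow> nat \<Rightarrow> real \<Rightarrow> real" where
  "freq b s n x = real (card {i \<in> {1..n}. \<forall>j<length s. digit b x (i + j) = s ! j}) / real n"

definition freq_vec :: "nat \<Rightarrow> nat \<Rightarrow> nat \<Rightarrow> real \<Rightarrow> (nat list \<Rightarrow> real)" where
  "freq_vec b k n x = (\<lambda>s. if s \<in> strings b k then freq b s n x else 0)"

definition Delta :: "nat \<Rightarrow> nat \<Rightarrow> (nat list \<Rightarrow> real) set" where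
  "Delta b k = {p. (\<forall>s. s \<notin> strings b k \<longrightarrow> p s = 0) \<and>
      (\<Sum>s\<in>strings b k. p s) = 1 \<and> (\<forall>s\<in>strings b k. p s \<ge> 0) \<and>
      (\<forall>s\<in>strings b (k - 1). (\<Sum>c<b. p (c # s)) = (\<Sum>c<b. p (s @ [c])))}"

text \<open>A_n applied to the sequence (pi_{b,1}, pi_{b,2}, ...): column i of a pairs with pi_{b,i+1}.\<close>

definition mat_transform :: "(nat \<Rightarrow> nat \<Rightarrow> real) \<Rightarrow> (nat \<Rightarrow> (nat list \<Rightarrow> real)) \<Rightarrow> nat \<Rightarrow> (nat list \<Rightarrow> real)" where
  "mat_transform a z n = (\<lambda>s. \<Sum>i. a n i * z i s)"

definition ideal_cluster_points :: "nat set set \<Rightarrow> (nat \<Rightarrow> 'a::topological_space) \<Rightarrow> 'a set" where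
  "ideal_cluster_points I f = {\<eta>. \<forall>U. open U \<and> \<eta> \<in> U \<longrightarrow> {n. f n \<in> U} \<notin> I}"

definition Gamma_set :: "nat \<Rightarrow> nat \<Rightarrow> real \<Rightarrow> nat set set \<Rightarrow> (nat \<Rightarrow> nat \<Rightarrow> real) \<Rightarrow> (nat list \<Rightarrow> real) set" where
  "Gamma_set b k x I a = ideal_cluster_points I (mat_transform a (\<lambda>i. freq_vec b k (Suc i) x))"

end

theory Submission
  imports Defs
begin

text \<open>
  Every cluster point lies in \<open>\<Delta>\<close> because the constraints defining \<open>\<Delta>\<close> hold for the frequency
  vectors up to \<open>O(1/n)\<close>, and both these constraints and, as the row sums of \<open>\<bar>a\<bar>\<close> tend to 1,
  nonnegativity survive the matrix transform in the limit.

  Conversely, a point of \<open>\<Delta>\<close> is a circulation on the de Bruijn graph, hence a nonnegative combination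
  of cycles. Concatenating periodic words with the right multiplicities shows that any finite
  digit prefix extends to a sequence whose string frequencies are eventually near a given point of
  \<open>\<Delta>\<close>; by regularity so are the transformed frequencies. By Talagrand's characterisation of meager
  ideals there are consecutive blocks of indices such that no set containing infinitely many of them
  is in the ideal. It thus suffices that infinitely often a whole block of transformed frequencies
  falls in a given basic open set, which is an intersection of countably many conditions each holding
  on a dense open set, since a block depends up to a small error on finitely many digits.
\<close>

section \<open>Meager ideals and cluster points\<close>

text \<open>The second hypothesis is applied to the interior of the closure of \<open>S\<close>: an
  open set disjoint from \<open>S\<close> is disjoint from the closure of \<open>S\<close> too, so a
  nonempty one cannot lie in that interior.\<close>

lemma nowhere_dense_inI:
  assumes "S \<subseteq> topspace X"
    and "\<And>W. openin X W \<Longrightarrow> W \<noteq> {} \<Longrightarrow> \<exists>V. openin X V \<and> V \<noteq> {} \<and> V \<subseteq> W \<and> V \<inter> S = {}"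
  shows "nowhere_dense_in X S"
proof -
  have "X interior_of (X closure_of S) = {}"
  proof (rule ccontr)
    let ?W = "X interior_of (X closure_of S)"
    assume "?W \<noteq> {}"
    then obtain V where V: "openin X V" "V \<noteq> {}" "V \<subseteq> ?W" "V \<inter> S = {}"
      using assms(2)[of ?W] by auto
    then have "V \<inter> X closure_of S = {}"
      by (simp add: openin_Int_closure_of_eq_empty)
    with V interior_of_subset[of X "X closure_of S"] show False by blast
  qed
  with assms(1) show ?thesis by (simp add: nowhere_dense_in_def)
qed

lemma meager_inI_countable:
  assumes "countable \<F>" and nd: "\<And>S. S \<in> \<F> \<Longrightarrow> nowhere_dense_in X S" and "T \<subseteq> \<Union>\<F>"
  shows "meager_in X T"
proof -
  \<comment> \<open>The empty set is added only to make the family nonempty, so that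
    \<open>from_nat_into\<close> enumerates it.\<close>
  have c: "countable (insert {} \<F>)" "insert {} \<F> \<noteq> {}" using assms(1) by auto
  have "nowhere_dense_in X {}" by (simp add: nowhere_dense_in_def)
  with nd have "\<forall>n. nowhere_dense_in X (from_nat_into (insert {} \<F>) n)"
    using from_nat_into[OF c(2)] by (metis insert_iff)
  moreover have "T \<subseteq> (\<Union>n. from_nat_into (insert {} \<F>) n)"
    using assms(3) range_from_nat_into[OF c(2) c(1)] by auto
  ultimately show ?thesis by (auto simp: meager_in_def)
qed

section \<open>Cantor space and Talagrand's interval criterion\<close>

lemma openin_cantor_agree: "openin cantor_topology {f. \<forall>i<n. f i = \<sigma> i}"
proof -
  have "{f. \<forall>i<n. f i = \<sigma> i} = PiE UNIV (\<lambda>i. if i < n then {\<sigma> i} else UNIV)"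
    by (auto simp: PiE_def Pi_def split: if_splits)
  moreover have "openin cantor_topology (PiE UNIV (\<lambda>i. if i < n then {\<sigma> i} else UNIV))"
    unfolding cantor_topology_def
    by (subst openin_PiE_gen) (auto intro: finite_subset[of _ "{..<n}"] split: if_splits)
  ultimately show ?thesis by simp
qed

lemma openin_cantor_contains_agree:
  assumes "openin cantor_topology U" "\<tau> \<in> U"
  obtains N where "\<And>f. (\<And>i. i < N \<Longrightarrow> f i = \<tau> i) \<Longrightarrow> f \<in> U"
proof -
  obtain X where X: "\<tau> \<in> PiE UNIV X" "finite {i. X i \<noteq> UNIV}" "PiE UNIV X \<subseteq> U"
    using product_topology_open_contains_basis[OF assms[unfolded cantor_topology_def]] by auto
  obtain N where N: "\<And>i. X i \<noteq> UNIV \<Longrightarrow> i < N"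
    using X(2) finite_nat_set_iff_bounded by auto
  show thesis
  proof
    fix f assume f: "\<And>i. i < N \<Longrightarrow> f i = \<tau> i"
    have "f i \<in> X i" for i
    proof (cases "i < N")
      case True
      then show ?thesis using X(1) f by (auto simp: PiE_def Pi_def)
    next
      case False
      then show ?thesis using N[of i] by auto
    qed
    then show "f \<in> U" using X(3) by (auto simp: PiE_def Pi_def)
  qed
qed

text \<open>The sequences that agree with \<open>\<sigma>\<close> below \<open>n\<close> form a
  nonempty open set, so one of them, \<open>\<tau>\<close>, lies outside the closure of
  \<open>F\<close>. The complement of the closure is open, and hence finitely many values of
  \<open>\<tau>\<close> already force a sequence out of \<open>F\<close>.\<close>

lemma nowhere_dense_cantor_avoid:
  assumes "nowhere_dense_in cantor_topology F"
  obtains N \<tau> where "N \<ge> n" "\<And>i. i < n \<Longrightarrow> \<tau> i = \<sigma> i"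
    "\<And>f. (\<And>i. i < N \<Longrightarrow> f i = \<tau> i) \<Longrightarrow> f \<notin> F"
proof -
  let ?C = "cantor_topology closure_of F"
  have top: "topspace cantor_topology = UNIV" by (simp add: cantor_topology_def)
  have "\<not> {f. \<forall>i<n. f i = \<sigma> i} \<subseteq> ?C"
  proof
    assume "{f. \<forall>i<n. f i = \<sigma> i} \<subseteq> ?C"
    then have "{f. \<forall>i<n. f i = \<sigma> i} \<subseteq> cantor_topology interior_of ?C"
      by (simp add: interior_of_maximal openin_cantor_agree)
    with assms show False by (auto simp: nowhere_dense_in_def)
  qed
  then obtain \<tau> where \<tau>: "\<And>i. i < n \<Longrightarrow> \<tau> i = \<sigma> i" "\<tau> \<notin> ?C" by auto
  have "openin cantor_topology (- ?C)"
    using closedin_closure_of[of cantor_topology F] by (simp add: closedin_def top Compl_eq_Diff_UNIV)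
  then obtain M where M: "\<And>f. (\<And>i. i < M \<Longrightarrow> f i = \<tau> i) \<Longrightarrow> f \<in> - ?C"
    using openin_cantor_contains_agree \<tau>(2) by (metis ComplI)
  have "F \<subseteq> ?C" by (simp add: closure_of_subset top)
  with M have "f \<notin> F" if "\<And>i. i < max n M \<Longrightarrow> f i = \<tau> i" for f
    using that by (metis ComplD less_max_iff_disj subsetD)
  with \<tau> that[of "max n M" \<tau>] show thesis by auto
qed

text \<open>The pattern \<open>t\<close> works for every initial segment at once: the finitely many pairs of
  an initial segment and a set are treated one after the other, lengthening \<open>t\<close> each time.\<close>

lemma nowhere_dense_cantor_uniform_avoid:
  fixes F :: "nat \<Rightarrow> (nat \<Rightarrow> bool) set"
  assumes nd: "\<And>l. nowhere_dense_in cantor_topology (F l)"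
  obtains N :: nat and t :: "nat \<Rightarrow> bool" where "N > n"
    "\<And>f l. l \<le> j \<Longrightarrow> (\<And>i. n \<le> i \<Longrightarrow> i < N \<Longrightarrow> f i = t i) \<Longrightarrow> f \<notin> F l"
proof -
  have ex: "\<exists>N>n. \<exists>t. \<forall>(A, l)\<in>Q. \<forall>f. (\<forall>i<n. f i = (i \<in> A)) \<and> (\<forall>i. n \<le> i \<and> i < N \<longrightarrow> f i = t i) \<longrightarrow> f \<notin> F l"
    if "finite Q" for Q :: "(nat set \<times> nat) set"
    using that
  proof (induction Q rule: finite_induct)
    case empty
    show ?case by auto
  next
    case (insert p Q)
    obtain A l where p: "p = (A, l)" by fastforce
    from insert.IH obtain N t where N: "N > n"
      and "\<forall>(A, l)\<in>Q. \<forall>f. (\<forall>i<n. f i = (i \<in> A)) \<and> (\<forall>i. n \<le> i \<and> i < N \<longrightarrow> f i = t i) \<longrightarrow> f \<notin> F l"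
      by (elim exE conjE)
    then have t: "f \<notin> F l" if "(A, l) \<in> Q" "\<forall>i<n. f i = (i \<in> A)" "\<forall>i. n \<le> i \<and> i < N \<longrightarrow> f i = t i" for A l f
      using that by auto
    obtain N' \<tau> where N': "N' \<ge> N"
      and \<tau>: "\<And>i. i < N \<Longrightarrow> \<tau> i = (if i < n then i \<in> A else t i)"
        "\<And>f. (\<And>i. i < N' \<Longrightarrow> f i = \<tau> i) \<Longrightarrow> f \<notin> F l"
      \<comment> \<open>The initial segment extended here is \<open>A\<close> below \<open>n\<close>
        followed by the old pattern \<open>t\<close>; the new pattern continues \<open>t\<close>, so
        what \<open>t\<close> achieves for \<open>Q\<close> is kept.\<close>
      using nowhere_dense_cantor_avoid[OF nd, of N "\<lambda>i. if i < n then i \<in> A else t i" l] by blast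
    have "\<forall>(B, m)\<in>insert p Q. \<forall>f. (\<forall>i<n. f i = (i \<in> B)) \<and> (\<forall>i. n \<le> i \<and> i < N' \<longrightarrow> f i = \<tau> i) \<longrightarrow> f \<notin> F m"
    proof (clarify)
      fix B m f
      assume Bm: "(B, m) \<in> insert p Q" and f: "\<forall>i<n. f i = (i \<in> B)" "\<forall>i. n \<le> i \<and> i < N' \<longrightarrow> f i = \<tau> i"
        and fF: "f \<in> F m"
      show False
      proof (cases "(B, m) \<in> Q")
        case True
        have "\<forall>i. n \<le> i \<and> i < N \<longrightarrow> f i = t i" using f(2) \<tau>(1) N' by auto
        with t[OF True f(1)] fF show False by blast
      next
        case False
        with Bm p have BA: "B = A" "m = l" by auto
        have "f i = \<tau> i" if "i < N'" for i
          using f \<tau>(1)[of i] N that BA by (cases "i < n") auto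
        with \<tau>(2) fF BA show False by blast
      qed
    qed
    with N N' show ?case by (intro exI[of _ N']) auto
  qed
  have "finite (Pow {..<n} \<times> {..j})" by simp
  from ex[OF this] obtain N t where N: "N > n"
    and "\<forall>(A, l)\<in>Pow {..<n} \<times> {..j}. \<forall>f. (\<forall>i<n. f i = (i \<in> A)) \<and> (\<forall>i. n \<le> i \<and> i < N \<longrightarrow> f i = t i) \<longrightarrow> f \<notin> F l"
    by (elim exE conjE)
  then have t: "f \<notin> F l" if "A \<subseteq> {..<n}" "l \<le> j" "\<forall>i<n. f i = (i \<in> A)" "\<forall>i. n \<le> i \<and> i < N \<longrightarrow> f i = t i" for A l f
    using that by auto
  show thesis
  proof (rule that[OF N])
    fix f l assume "l \<le> j" "\<And>i. n \<le> i \<Longrightarrow> i < N \<Longrightarrow> f i = t i"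
    then show "f \<notin> F l" using t[of "{i. i < n \<and> f i}" l f] by auto
  qed
qed

text \<open>Block \<open>j\<close> carries a pattern that forces every sequence following it out of
  \<open>F 0\<close>, ..., \<open>F j\<close>. If \<open>A\<close> were in the ideal and contained
  infinitely many blocks, its subset \<open>B\<close>, which copies the patterns on these blocks and
  is empty elsewhere, would be in the ideal and so in some \<open>F l\<close>; but \<open>B\<close>
  follows the pattern of a block with index at least \<open>l\<close>.\<close>

lemma meager_ideal_intervals:
  assumes "meager_ideal I"
  obtains r :: "nat \<Rightarrow> nat" where "strict_mono r"
    "\<And>A. (\<And>m. \<exists>j\<ge>m. {r j..<r (Suc j)} \<subseteq> A) \<Longrightarrow> A \<notin> I"
proof -
  have sub: "\<And>A B. A \<in> I \<Longrightarrow> B \<subseteq> A \<Longrightarrow> B \<in> I"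
    using assms by (auto simp: meager_ideal_def is_ideal_def)
  obtain F :: "nat \<Rightarrow> (nat \<Rightarrow> bool) set" where nd: "\<And>l. nowhere_dense_in cantor_topology (F l)"
    and cover: "(\<lambda>A n. n \<in> A) ` I \<subseteq> (\<Union>l. F l)"
    using assms by (auto simp: meager_ideal_def meager_in_def)
  \<comment> \<open>A pair consists of the end of the block starting at \<open>n\<close> and of the
    pattern on that block.\<close>
  let ?P = "\<lambda>n j p. fst p > n \<and> (\<forall>f l. l \<le> j \<longrightarrow> (\<forall>i. n \<le> i \<and> i < fst p \<longrightarrow> f i = snd p i) \<longrightarrow> f \<notin> F l)"
  define p where "p n j = (SOME p. ?P n j p)" for n j :: nat
  have P: "?P n j (p n j)" for n j
  proof -
    have "\<exists>p. ?P n j p"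
    proof (rule nowhere_dense_cantor_uniform_avoid[OF nd, of n j])
      fix N t
      assume "N > n" "\<And>f l. l \<le> j \<Longrightarrow> (\<And>i. n \<le> i \<Longrightarrow> i < N \<Longrightarrow> f i = t i) \<Longrightarrow> f \<notin> F l"
      then show ?thesis by (intro exI[of _ "(N, t)"]) auto
    qed
    then show ?thesis unfolding p_def by (rule someI_ex)
  qed
  define r where "r = rec_nat 0 (\<lambda>j n. fst (p n j))"
  have r_Suc: "r (Suc j) = fst (p (r j) j)" for j by (simp add: r_def)
  have sm: "strict_mono r" by (rule strict_mono_Suc_iff[THEN iffD2]) (simp add: r_Suc P)
  have inj: "j = j'" if "r j \<le> i" "i < r (Suc j)" "r j' \<le> i" "i < r (Suc j')" for i j j'
    using that sm by (metis less_Suc_eq_le order_antisym_conv order_le_less_trans strict_mono_less)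
  show thesis
  proof (rule that[OF sm])
    fix A assume A: "\<And>m. \<exists>j\<ge>m. {r j..<r (Suc j)} \<subseteq> A"
    define B where "B = {i. \<exists>j. r j \<le> i \<and> i < r (Suc j) \<and> {r j..<r (Suc j)} \<subseteq> A \<and> snd (p (r j) j) i}"
    show "A \<notin> I"
    proof
      assume "A \<in> I"
      moreover have "B \<subseteq> A" by (auto simp: B_def)
      ultimately have "B \<in> I" by (rule sub)
      then obtain l where l: "(\<lambda>n. n \<in> B) \<in> F l" using cover by blast
      obtain j where j: "j \<ge> l" "{r j..<r (Suc j)} \<subseteq> A" using A by blast
      have "i \<in> B \<longleftrightarrow> snd (p (r j) j) i" if "r j \<le> i" "i < r (Suc j)" for i
      proof
        assume "i \<in> B"
        then obtain j' where "r j' \<le> i" "i < r (Suc j')" "snd (p (r j') j') i" by (auto simp: B_def)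
        then show "snd (p (r j) j) i" using inj[OF that, of j'] by simp
      next
        assume "snd (p (r j) j) i"
        then show "i \<in> B" unfolding B_def using that j(2) by blast
      qed
      then have "(\<lambda>n. n \<in> B) \<notin> F l"
        using P[of "r j" j] j(1) by (simp add: r_Suc)
      with l show False by blast
    qed
  qed
qed

text \<open>If \<open>g \<eta>\<close> differed from \<open>c\<close>, the points whose
  \<open>g\<close>-value stays away from \<open>c\<close> would include a neighbourhood of
  \<open>\<eta>\<close> that the sequence visits only finitely often, and finite sets are in the
  ideal. This carries equations that hold in the limit over to all cluster points.\<close>

lemma ideal_cluster_point_limit:
  fixes f :: "nat \<Rightarrow> 'a::topological_space" and g :: "'a \<Rightarrow> real"
  assumes "\<eta> \<in> ideal_cluster_points I f" "is_ideal I" "continuous_on UNIV g" "(\<lambda>n. g (f n)) \<longlonglongrightarrow> c"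
  shows "g \<eta> = c"
proof (rule ccontr)
  assume ne: "g \<eta> \<noteq> c"
  define U where "U = g -` (- cball c (\<bar>g \<eta> - c\<bar> / 2))"
  have "open U" unfolding U_def by (intro open_vimage assms(3)) auto
  moreover have "\<eta> \<in> U" using ne by (auto simp: U_def dist_real_def abs_minus_commute)
  ultimately have "{n. f n \<in> U} \<notin> I" using assms(1) by (auto simp: ideal_cluster_points_def)
  moreover have "\<forall>\<^sub>F n in sequentially. dist (g (f n)) c < \<bar>g \<eta> - c\<bar> / 2"
    using assms(4) ne by (intro tendstoD) auto
  then have "\<forall>\<^sub>F n in cofinite. f n \<notin> U"
    by (auto simp: cofinite_eq_sequentially U_def dist_commute elim: eventually_mono)
  then have "finite {n. f n \<in> U}" by (simp add: eventually_cofinite)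
  ultimately show False using assms(2) by (auto simp: is_ideal_def)
qed

section \<open>Frequencies of strings in digit sequences\<close>

definition window :: "(nat \<Rightarrow> nat) \<Rightarrow> nat \<Rightarrow> nat \<Rightarrow> nat list" where
  "window d k i = map (\<lambda>j. d (i + j)) [0..<k]"

text \<open>Digit sequences are indexed from 0 here. Only the starting position of an occurrence is
  bounded by \<open>n\<close>; the occurrence may run past \<open>n\<close>. This agrees with
  \<open>freq\<close> and makes \<open>cnt_add\<close> exact, without boundary terms.\<close>

definition cnt :: "(nat \<Rightarrow> nat) \<Rightarrow> nat list \<Rightarrow> nat \<Rightarrow> nat" where
  "cnt d s n = card {i. i < n \<and> window d (length s) i = s}"

lemma length_window [simp]: "length (window d k i) = k"
  by (simp add: window_def)

lemma window_in_strings: "(\<And>i. d i < b) \<Longrightarrow> window d k i \<in> strings b k"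
  by (auto simp: window_def strings_def)

lemma window_eq_iff: "window d (length s) i = s \<longleftrightarrow> (\<forall>j<length s. d (i + j) = s ! j)"
  using list_eq_iff_nth_eq[of "window d (length s) i" s] by (simp add: window_def)

lemma window_cong: "(\<And>j. i \<le> j \<Longrightarrow> j < i + k \<Longrightarrow> d j = d' j) \<Longrightarrow> window d k i = window d' k i"
  by (auto simp: window_def)

lemma window_shift: "window (\<lambda>i. d (m + i)) k i = window d k (m + i)"
  by (simp add: window_def add.assoc)

lemma window_Suc: "window d (Suc k) i = d i # window d k (Suc i)"
  by (simp add: window_def upt_conv_Cons map_Suc_upt[symmetric] del: upt_Suc)

lemma window_Suc_snoc: "window d (Suc k) i = window d k i @ [d (i + k)]"
  by (simp add: window_def)

lemma finite_strings [simp]: "finite (strings b k)"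
  using finite_lists_length_eq[of "{..<b}" k] by (auto simp: strings_def subset_eq lessThan_def intro: rev_finite_subset)

lemma Cons_in_strings: "c # s \<in> strings b (Suc k) \<longleftrightarrow> c < b \<and> s \<in> strings b k"
  by (auto simp: strings_def)

lemma snoc_in_strings: "s @ [c] \<in> strings b (Suc k) \<longleftrightarrow> c < b \<and> s \<in> strings b k"
  by (auto simp: strings_def)

lemma cnt_eq_sum: "cnt d s n = (\<Sum>i<n. of_bool (window d (length s) i = s))"
proof -
  have "{i. i < n \<and> window d (length s) i = s} = {..<n} \<inter> {i. window d (length s) i = s}" by auto
  then show ?thesis by (simp add: cnt_def of_bool_def sum.If_cases)
qed

lemma cnt_le: "cnt d s n \<le> n"
  unfolding cnt_eq_sum using sum_bounded_above[of "{..<n}" "\<lambda>i. of_bool (window d (length s) i = s)" "1::nat"] by simp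

lemma cnt_add: "cnt d s (m + n) = cnt d s m + cnt (\<lambda>i. d (m + i)) s n"
proof -
  have "{..<m + n} = {..<m} \<union> (\<lambda>i. m + i) ` {..<n}"
    by (auto simp: image_iff) (metis add_diff_inverse_nat lessThan_iff nat_add_left_cancel_less)
  moreover have "{..<m} \<inter> (\<lambda>i. m + i) ` {..<n} = {}" by auto
  ultimately show ?thesis
    by (simp add: cnt_eq_sum sum.union_disjoint sum.reindex window_shift del: sum_of_bool_eq)
qed

lemma cnt_periodic:
  assumes "\<And>i. d (L + i) = d i"
  shows "cnt d s (q * L + r) = q * cnt d s L + cnt d s r"
proof (induction q)
  case (Suc q)
  have "cnt d s (Suc q * L + r) = cnt d s (L + (q * L + r))" by (simp add: algebra_simps)
  also have "\<dots> = cnt d s L + cnt d s (q * L + r)" by (simp add: cnt_add assms)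
  finally show ?case using Suc by simp
qed simp

lemma cnt_cong: "(\<And>i. i < n + length s \<Longrightarrow> d i = d' i) \<Longrightarrow> cnt d s n = cnt d' s n"
  unfolding cnt_eq_sum by (intro sum.cong) (auto cong: window_cong)

text \<open>Only windows that start at one of the last \<open>length s\<close> positions can see
  digits on which the two sequences differ.\<close>

lemma cnt_agree_le:
  assumes "\<And>i. i < n \<Longrightarrow> d i = d' i"
  shows "cnt d s n \<le> cnt d' s n + length s"
proof -
  have "{i. i < n \<and> window d (length s) i = s} \<subseteq> {i. i < n \<and> window d' (length s) i = s} \<union> {n - length s..<n}"
  proof
    fix i assume i: "i \<in> {i. i < n \<and> window d (length s) i = s}"
    show "i \<in> {i. i < n \<and> window d' (length s) i = s} \<union> {n - length s..<n}"
    proof (cases "i < n - length s")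
      case True
      then have "window d (length s) i = window d' (length s) i" by (intro window_cong assms) auto
      with i show ?thesis by simp
    qed (use i in auto)
  qed
  then have "cnt d s n \<le> card ({i. i < n \<and> window d' (length s) i = s} \<union> {n - length s..<n})"
    unfolding cnt_def by (intro card_mono) auto
  also have "\<dots> \<le> cnt d' s n + card {n - length s..<n}"
    unfolding cnt_def by (rule card_Un_le)
  finally show ?thesis by simp
qed

lemma cnt_agree:
  assumes "\<And>i. i < n \<Longrightarrow> d i = d' i"
  shows "\<bar>real (cnt d s n) - real (cnt d' s n)\<bar> \<le> real (length s)"
  using cnt_agree_le[of n d d' s] cnt_agree_le[of n d' d s] assms by auto

lemma sum_cnt:
  assumes "\<And>i. d i < b"
  shows "(\<Sum>s\<in>strings b k. cnt d s n) = n"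
proof -
  have "(\<Sum>s\<in>strings b k. cnt d s n) = (\<Sum>s\<in>strings b k. \<Sum>i<n. of_bool (window d k i = s))"
    by (intro sum.cong) (auto simp: cnt_eq_sum strings_def)
  also have "\<dots> = (\<Sum>i<n. \<Sum>s\<in>strings b k. of_bool (window d k i = s))"
    by (rule sum.swap)
  also have "\<dots> = (\<Sum>i<n. 1)"
    using window_in_strings[of d b k] assms
    by (intro sum.cong) (auto simp: of_bool_def)
  finally show ?thesis by simp
qed

text \<open>Summing out the first letter leaves a window that starts one place later, whereas
  summing out the last one, in \<open>sum_cnt_snoc\<close>, leaves the window in place. The flow
  equation of \<Delta> thus fails for counts only by the defect in \<open>cnt_shift_one\<close>, at
  most one occurrence.\<close>

lemma sum_cnt_Cons:
  assumes "\<And>i. d i < b"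
  shows "(\<Sum>c<b. cnt d (c # s) n) = cnt (\<lambda>i. d (1 + i)) s n"
proof -
  have "(\<Sum>c<b. cnt d (c # s) n) = (\<Sum>c<b. \<Sum>i<n. of_bool (d i = c \<and> window d (length s) (Suc i) = s))"
    by (intro sum.cong) (auto simp: cnt_eq_sum window_Suc)
  also have "\<dots> = (\<Sum>i<n. \<Sum>c<b. of_bool (d i = c \<and> window d (length s) (Suc i) = s))"
    by (rule sum.swap)
  also have "\<dots> = (\<Sum>i<n. of_bool (window d (length s) (Suc i) = s))"
    using assms by (intro sum.cong) (auto simp: of_bool_def)
  finally show ?thesis by (simp only: cnt_eq_sum window_shift) simp
qed

lemma sum_cnt_snoc:
  assumes "\<And>i. d i < b"
  shows "(\<Sum>c<b. cnt d (s @ [c]) n) = cnt d s n"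
proof -
  have "(\<Sum>c<b. cnt d (s @ [c]) n) = (\<Sum>c<b. \<Sum>i<n. of_bool (window d (length s) i = s \<and> d (i + length s) = c))"
    by (intro sum.cong) (auto simp: cnt_eq_sum window_Suc_snoc)
  also have "\<dots> = (\<Sum>i<n. \<Sum>c<b. of_bool (window d (length s) i = s \<and> d (i + length s) = c))"
    by (rule sum.swap)
  also have "\<dots> = cnt d s n"
    unfolding cnt_eq_sum using assms by (intro sum.cong) (auto simp: of_bool_def)
  finally show ?thesis .
qed

text \<open>Both sides count the occurrences that start below \<open>n + 1\<close>, with the last or
  the first starting position split off.\<close>

lemma cnt_shift_one: "cnt d s n + cnt (\<lambda>i. d (n + i)) s 1 = cnt d s 1 + cnt (\<lambda>i. d (1 + i)) s n"
  using cnt_add[of d s n 1] cnt_add[of d s 1 n] by (simp add: add.commute)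

section \<open>Circulations on the de Bruijn graph\<close>

text \<open>Strings of length \<open>m\<close> are the vertices and strings of length
  \<open>Suc m\<close> the edges. An edge of positive weight gives its end vertex positive inflow,
  hence positive outflow, so some positive edge leaves it. Following such edges must repeat one, as
  there are finitely many; the closed walk is read as a periodic word.\<close>

lemma positive_cycle:
  assumes nonneg: "\<And>s. s \<in> strings b (Suc m) \<Longrightarrow> p s \<ge> (0::real)"
    and flow: "\<And>s. s \<in> strings b m \<Longrightarrow> (\<Sum>c<b. p (c # s)) = (\<Sum>c<b. p (s @ [c]))"
    and x: "x \<in> strings b (Suc m)" "p x > 0"
  obtains e L where "L > 0" "\<forall>i. e i < b" "\<forall>i. e (L + i) = e i" "\<forall>i. p (window e (Suc m) i) > 0"
proof -
  define P where "P = {s \<in> strings b (Suc m). p s > 0}"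
  have "\<exists>c<b. p (tl s @ [c]) > 0" if sP: "s \<in> P" for s
  proof -
    obtain c t where s: "s = c # t" using sP by (cases s) (auto simp: P_def strings_def)
    have t: "c < b" "t \<in> strings b m" using sP by (auto simp: P_def s Cons_in_strings)
    have "0 < p (c # t)" using sP s by (simp add: P_def)
    also have "p (c # t) \<le> (\<Sum>c<b. p (c # t))"
      using t by (intro member_le_sum nonneg) (auto simp: Cons_in_strings)
    also have "\<dots> = (\<Sum>c<b. p (t @ [c]))" using flow t by simp
    finally obtain c' where "c' \<in> {..<b}" "p (t @ [c']) > 0"
      using sum_nonpos[of "{..<b}" "\<lambda>c. p (t @ [c])"] by (meson not_le)
    then show ?thesis by (auto simp: s)
  qed
  then obtain g where g: "\<And>s. s \<in> P \<Longrightarrow> g s < b \<and> p (tl s @ [g s]) > 0" by metis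
  define f where "f s = tl s @ [g s]" for s
  have fP: "f s \<in> P" if "s \<in> P" for s
  proof -
    have "tl s \<in> strings b m" using that by (cases s) (auto simp: P_def strings_def)
    then show ?thesis using g[OF that] by (simp add: f_def P_def snoc_in_strings)
  qed
  have xP: "x \<in> P" using x by (simp add: P_def)
  have iter: "(f ^^ i) x \<in> P" for i by (induction i) (auto simp: xP fP)
  have "\<not> inj (\<lambda>i. (f ^^ i) x)"
  proof
    assume "inj (\<lambda>i. (f ^^ i) x)"
    then have "infinite (range (\<lambda>i. (f ^^ i) x))" using range_inj_infinite by blast
    moreover have "finite P" by (simp add: P_def)
    ultimately show False using iter by (meson finite_subset image_subsetI)
  qed
  then obtain i' j' where "i' \<noteq> j'" "(f ^^ i') x = (f ^^ j') x" by (auto simp: inj_def)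
  then obtain i j where ij: "i < j" "(f ^^ i) x = (f ^^ j) x"
    by (cases i' j' rule: linorder_cases) auto
  define y where "y = (f ^^ i) x"
  define L where "L = j - i"
  \<comment> \<open>The word lists the first letters of the edges. Successive edges overlap in
    \<open>m\<close> letters, so letter \<open>l\<close> of an edge is the first letter of the edge
    \<open>l\<close> steps later, and the windows of \<open>e\<close> are exactly the edges of the
    walk.\<close>
  define e where "e n = hd ((f ^^ n) y)" for n
  have yP: "(f ^^ n) y \<in> P" for n
    using iter[of "n + i"] by (simp add: y_def funpow_add)
  have per: "(f ^^ (L + n)) y = (f ^^ n) y" for n
  proof -
    have "(f ^^ L) y = (f ^^ (L + i)) x" by (simp add: y_def funpow_add)
    also have "\<dots> = y" using ij by (simp add: L_def y_def)
    finally have "(f ^^ L) y = y" .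
    then show ?thesis by (simp add: add.commute[of L] funpow_add)
  qed
  have nth: "(f ^^ n) y ! l = e (n + l)" if "l < Suc m" for n l
    using that
  proof (induction l arbitrary: n)
    case 0
    have "(f ^^ n) y \<noteq> []" using yP[of n] by (auto simp: P_def strings_def)
    then show ?case by (simp add: e_def hd_conv_nth)
  next
    case (Suc l)
    have len: "length ((f ^^ n) y) = Suc m" using yP[of n] by (auto simp: P_def strings_def)
    have "(f ^^ n) y ! Suc l = f ((f ^^ n) y) ! l"
      using Suc.prems len by (auto simp: f_def nth_append nth_tl)
    also have "\<dots> = e (Suc n + l)" using Suc.IH[of "Suc n"] Suc.prems by simp
    finally show ?case by simp
  qed
  have win: "window e (Suc m) n = (f ^^ n) y" for n
  proof (rule nth_equalityI)
    show "length (window e (Suc m) n) = length ((f ^^ n) y)"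
      using yP[of n] by (simp add: P_def strings_def)
    fix l assume "l < length (window e (Suc m) n)"
    then have l: "l < Suc m" by simp
    show "window e (Suc m) n ! l = (f ^^ n) y ! l"
      unfolding nth[OF l] using l by (simp add: window_def del: upt_Suc)
  qed
  show thesis
  proof
    show "L > 0" using ij by (simp add: L_def)
    show "\<forall>n. e (L + n) = e n" by (simp add: e_def per)
    show "\<forall>n. p (window e (Suc m) n) > 0" using yP by (simp add: win P_def)
    show "\<forall>n. e n < b"
    proof
      fix n
      have "(f ^^ n) y \<in> strings b (Suc m)" using yP[of n] by (simp add: P_def)
      then show "e n < b" unfolding e_def by (cases "(f ^^ n) y") (auto simp: strings_def)
    qed
  qed
qed

text \<open>Induction on the support: a cycle inside the support is subtracted with the largest
  weight that keeps \<open>p\<close> nonnegative, and the corresponding periodic word is appended.\<close>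

lemma circulation_counts:
  assumes "b > 0"
    and "\<And>s. s \<in> strings b (Suc m) \<Longrightarrow> p s \<ge> (0::real)"
    and "\<And>s. s \<in> strings b m \<Longrightarrow> (\<Sum>c<b. p (c # s)) = (\<Sum>c<b. p (s @ [c]))"
  shows "\<exists>C. \<forall>T\<ge>0. \<exists>d n. (\<forall>i. d i < b) \<and> (\<forall>s\<in>strings b (Suc m). \<bar>real (cnt d s n) - T * p s\<bar> \<le> C)"
  using assms(2,3)
proof (induction "card {s \<in> strings b (Suc m). p s > 0}" arbitrary: p rule: less_induct)
  case less
  let ?S = "strings b (Suc m)"
  show ?case
  proof (cases "\<exists>x\<in>?S. p x > 0")
    case False
    then have "p s = 0" if "s \<in> ?S" for s using less.prems(1)[OF that] that by force
    \<comment> \<open>With zero weights the empty word, \<open>n = 0\<close>, matches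
      exactly.\<close>
    then show ?thesis using \<open>b > 0\<close>
      by (intro exI[of _ 0] allI impI exI[of _ "\<lambda>_. 0"]) (auto simp: cnt_def)
  next
    case True
    then obtain x where x: "x \<in> ?S" "p x > 0" by blast
    obtain e L where e': "L > 0" "\<forall>i. e i < b" "\<forall>i. e (L + i) = e i" "\<forall>i. p (window e (Suc m) i) > 0"
      by (rule positive_cycle[where p = p, OF less.prems x]) (assumption | erule (3) that)+
    then have e: "e i < b" "e (L + i) = e i" "p (window e (Suc m) i) > 0" for i by auto
    define \<nu> where "\<nu> s = real (cnt e s L)" for s
    have \<nu>_pos: "p s > 0" if "s \<in> ?S" "\<nu> s > 0" for s
    proof -
      have "{i. i < L \<and> window e (length s) i = s} \<noteq> {}"
        using that(2) by (auto simp: \<nu>_def cnt_def simp del: Collect_empty_eq)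
      then show ?thesis using e(3) that(1) by (auto simp: strings_def)
    qed
    \<comment> \<open>Moving a word of period \<open>L\<close> by one place does not change its
      counts over a period, so these counts are themselves a circulation.\<close>
    have \<nu>_flow: "(\<Sum>c<b. \<nu> (c # s)) = (\<Sum>c<b. \<nu> (s @ [c]))" for s
    proof -
      have "cnt (\<lambda>i. e (1 + i)) s L = cnt e s L"
        using cnt_shift_one[of e s L] by (simp add: e(2))
      then have "(\<Sum>c<b. cnt e (c # s) L) = (\<Sum>c<b. cnt e (s @ [c]) L)"
        by (simp only: sum_cnt_Cons[of e, OF e(1)] sum_cnt_snoc[of e, OF e(1)])
      then show ?thesis unfolding \<nu>_def by (metis of_nat_sum)
    qed
    define Q where "Q = {s \<in> ?S. \<nu> s > 0}"
    have "window e (Suc m) 0 \<in> Q"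
    proof -
      have "0 \<in> {i. i < L \<and> window e (length (window e (Suc m) 0)) i = window e (Suc m) 0}"
        using e'(1) by simp
      then have "cnt e (window e (Suc m) 0) L > 0"
        unfolding cnt_def by (subst card_gt_0_iff) auto
      then show ?thesis using window_in_strings[of e b] e(1) by (simp add: Q_def \<nu>_def)
    qed
    then have Q: "finite Q" "Q \<noteq> {}" by (auto simp: Q_def)
    define \<alpha> where "\<alpha> = Min ((\<lambda>s. p s / \<nu> s) ` Q)"
    have \<alpha>_le: "\<alpha> \<le> p s / \<nu> s" if "s \<in> Q" for s using Q that by (simp add: \<alpha>_def)
    have "\<alpha> \<in> (\<lambda>s. p s / \<nu> s) ` Q" unfolding \<alpha>_def using Q by (intro Min_in) auto
    then obtain z where z: "z \<in> Q" "\<alpha> = p z / \<nu> z" by blast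
    have zp: "z \<in> ?S" "p z > 0" "\<nu> z > 0" using z(1) \<nu>_pos by (auto simp: Q_def)
    have \<alpha>: "\<alpha> > 0" using zp z(2) by simp
    define p' where "p' s = p s - \<alpha> * \<nu> s" for s
    have p'_le: "p' s \<le> p s" for s using \<alpha> by (simp add: p'_def \<nu>_def)
    have p'_nonneg: "p' s \<ge> 0" if "s \<in> ?S" for s
    proof (cases "\<nu> s > 0")
      case True
      then show ?thesis using \<alpha>_le[of s] that by (simp add: p'_def Q_def pos_le_divide_eq)
    next
      case False
      then show ?thesis using less.prems(1)[OF that] by (simp add: p'_def \<nu>_def)
    qed
    have p'_flow: "(\<Sum>c<b. p' (c # s)) = (\<Sum>c<b. p' (s @ [c]))" if "s \<in> strings b m" for s
      using less.prems(2)[OF that] \<nu>_flow[of s] by (simp add: p'_def sum_subtractf flip: sum_distrib_left)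
    \<comment> \<open>The minimiser \<open>z\<close> leaves the support and no string enters it,
      since \<open>p'\<close> is at most \<open>p\<close>; the induction measure drops.\<close>
    have "p' z = 0" using z(2) zp by (simp add: p'_def)
    then have "{s \<in> ?S. p' s > 0} \<subset> {s \<in> ?S. p s > 0}"
      using p'_le zp by (force intro: less_le_trans)
    then have "card {s \<in> ?S. p' s > 0} < card {s \<in> ?S. p s > 0}" by (intro psubset_card_mono) auto
    from less.hyps[OF this p'_nonneg p'_flow] obtain C where
      C: "\<And>T. T \<ge> 0 \<Longrightarrow> \<exists>d n. (\<forall>i. d i < b) \<and> (\<forall>s\<in>?S. \<bar>real (cnt d s n) - T * p' s\<bar> \<le> C)"
      by blast
    \<comment> \<open>The added \<open>Suc m\<close> pays for windows that run from the old word
      into the new one, and \<open>L\<close> for rounding \<open>T * \<alpha>\<close> down to a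
      whole number of periods.\<close>
    have "\<exists>d n. (\<forall>i. d i < b) \<and> (\<forall>s\<in>?S. \<bar>real (cnt d s n) - T * p s\<bar> \<le> C + Suc m + L)" if T: "T \<ge> 0" for T
    proof -
      obtain d n where d: "\<And>i. d i < b" "\<And>s. s \<in> ?S \<Longrightarrow> \<bar>real (cnt d s n) - T * p' s\<bar> \<le> C"
        using C[OF T] by blast
      define q where "q = nat \<lfloor>T * \<alpha>\<rfloor>"
      have q: "\<bar>real q - T * \<alpha>\<bar> \<le> 1"
      proof -
        have "T * \<alpha> \<ge> 0" using T \<alpha> by simp
        then show ?thesis unfolding q_def by linarith
      qed
      define d' where "d' i = (if i < n then d i else e (i - n))" for i
      have "\<bar>real (cnt d' s (n + q * L)) - T * p s\<bar> \<le> C + Suc m + L" if s: "s \<in> ?S" for s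
      proof -
        have "cnt d' s (n + q * L) = cnt d' s n + q * cnt e s L"
          using cnt_periodic[of e L s q 0] e(2) by (simp add: cnt_add d'_def cnt_def[of _ _ 0])
        moreover have "\<bar>real (cnt d' s n) - real (cnt d s n)\<bar> \<le> Suc m"
          using cnt_agree[of n d' d s] s by (simp add: d'_def strings_def)
        moreover have "\<bar>real q * \<nu> s - T * \<alpha> * \<nu> s\<bar> \<le> L"
        proof -
          have "\<bar>real q * \<nu> s - T * \<alpha> * \<nu> s\<bar> = \<bar>real q - T * \<alpha>\<bar> * \<nu> s"
            by (simp add: \<nu>_def abs_mult flip: left_diff_distrib)
          also have "\<dots> \<le> 1 * real L"
            using cnt_le[of e s L] q by (intro mult_mono) (auto simp: \<nu>_def)
          finally show ?thesis by simp
        qed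
        moreover have "T * p s = T * p' s + T * \<alpha> * \<nu> s" by (simp add: p'_def algebra_simps)
        moreover have "real (q * cnt e s L) = real q * \<nu> s" by (simp add: \<nu>_def)
        ultimately show ?thesis using d(2)[OF s] by linarith
      qed
      moreover have "\<forall>i. d' i < b" using d(1) e(1) by (simp add: d'_def)
      ultimately show ?thesis by blast
    qed
    then show ?thesis by blast
  qed
qed

section \<open>Digit sequences with prescribed frequencies\<close>

text \<open>The error in \<open>circulation_counts\<close> does not grow with the scale
  \<open>T\<close>. For large \<open>T\<close> it is a small fraction of the word length, and
  repeating the word periodically keeps that relative error; an incomplete last period costs at most
  \<open>L\<close>, which is negligible for large \<open>n\<close>.\<close>

lemma Delta_frequencies:
  assumes "b > 0" "k > 0" "\<eta> \<in> Delta b k" "\<epsilon> > 0"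
  obtains d where "\<forall>i. d i < b"
    "\<forall>\<^sub>F n in sequentially. \<forall>s\<in>strings b k. \<bar>real (cnt d s n) - real n * \<eta> s\<bar> \<le> \<epsilon> * real n"
proof -
  let ?S = "strings b k"
  obtain m where m: "k = Suc m" using \<open>k > 0\<close> gr0_implies_Suc by blast
  have \<eta>: "\<And>s. s \<in> ?S \<Longrightarrow> \<eta> s \<ge> 0" "sum \<eta> ?S = 1"
    "\<And>s. s \<in> strings b m \<Longrightarrow> (\<Sum>c<b. \<eta> (c # s)) = (\<Sum>c<b. \<eta> (s @ [c]))"
    using assms(3) by (auto simp: Delta_def m)
  have \<eta>1: "\<eta> s \<le> 1" if "s \<in> ?S" for s
    using member_le_sum[of s ?S \<eta>] \<eta>(1,2) that by simp
  have "\<exists>C. \<forall>T\<ge>0. \<exists>d n. (\<forall>i. d i < b) \<and> (\<forall>s\<in>?S. \<bar>real (cnt d s n) - T * \<eta> s\<bar> \<le> C)"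
    unfolding m by (rule circulation_counts[where p = \<eta>]) (use assms(1) \<eta>(1,3) in \<open>auto simp: m\<close>)
  then obtain C where C: "\<forall>T\<ge>0. \<exists>d n. (\<forall>i. d i < b) \<and> (\<forall>s\<in>?S. \<bar>real (cnt d s n) - T * \<eta> s\<bar> \<le> C)" ..
  \<comment> \<open>Since all counts add up to the length \<open>L\<close> and \<open>\<eta>\<close>
    sums to 1, adding the individual errors bounds the distance between \<open>L\<close> and
    \<open>T\<close> by \<open>B\<close>.\<close>
  define B where "B = real (card ?S) * \<bar>C\<bar>"
  \<comment> \<open>The error per period: \<open>C\<close> from the counts, \<open>B\<close> from
    replacing \<open>T\<close> by the true length, and \<open>k\<close> from windows that cross the
    end of the period.\<close>
  define K where "K = \<bar>C\<bar> + B + k"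
  have BK: "B \<ge> 0" "K \<ge> 0" by (auto simp: B_def K_def)
  \<comment> \<open>Chosen so that \<open>L\<close> is at least
    \<open>2 * K / \<epsilon> + 1\<close>: the period is nonempty and its error is at most half of
    \<open>\<epsilon> * L\<close>.\<close>
  define T where "T = 2 * K / \<epsilon> + B + 1"
  have T: "T \<ge> 0" using BK assms(4) by (simp add: T_def)
  then obtain d L where d: "\<And>i. d i < b" "\<And>s. s \<in> ?S \<Longrightarrow> \<bar>real (cnt d s L) - T * \<eta> s\<bar> \<le> C"
    using C[rule_format, of T] by blast
  have LT: "\<bar>real L - T\<bar> \<le> B"
  proof -
    have "(\<Sum>s\<in>?S. real (cnt d s L) - T * \<eta> s) = real L - T"
      using sum_cnt[of d b L k] d(1) \<eta>(2) by (simp add: sum_subtractf flip: sum_distrib_left of_nat_sum)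
    moreover have "\<bar>\<Sum>s\<in>?S. real (cnt d s L) - T * \<eta> s\<bar> \<le> (\<Sum>s\<in>?S. \<bar>C\<bar>)"
      using d(2) by (intro order_trans[OF sum_abs] sum_mono) force
    ultimately show ?thesis by (simp add: B_def)
  qed
  then have L: "real L \<ge> 2 * K / \<epsilon> + 1" by (simp add: T_def)
  moreover have "2 * K / \<epsilon> \<ge> 0" using BK assms(4) by simp
  ultimately have L0: "L > 0" by linarith
  have KL: "K \<le> \<epsilon> / 2 * real L"
  proof -
    have "2 * K / \<epsilon> \<le> real L" using L by simp
    then show ?thesis using assms(4) by (simp add: field_simps)
  qed
  define e where "e i = d (i mod L)" for i
  have per: "e (L + i) = e i" for i by (simp add: e_def)
  have eL: "\<bar>real (cnt e s L) - real L * \<eta> s\<bar> \<le> K" if s: "s \<in> ?S" for s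
  proof -
    have "\<bar>real (cnt e s L) - real (cnt d s L)\<bar> \<le> k"
      using cnt_agree[of L e d s] s by (simp add: e_def strings_def)
    moreover have "\<bar>real L * \<eta> s - T * \<eta> s\<bar> \<le> B"
    proof -
      have "\<bar>real L * \<eta> s - T * \<eta> s\<bar> = \<bar>real L - T\<bar> * \<eta> s"
        using \<eta>(1)[OF s] by (simp add: abs_mult flip: left_diff_distrib)
      also have "\<dots> \<le> B * 1" using LT \<eta>(1)[OF s] \<eta>1[OF s] BK by (intro mult_mono) auto
      finally show ?thesis by simp
    qed
    ultimately show ?thesis using d(2)[OF s] unfolding K_def by linarith
  qed
  have bound: "\<bar>real (cnt e s n) - real n * \<eta> s\<bar> \<le> \<epsilon> / 2 * real n + real L" if s: "s \<in> ?S" for s n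
  proof -
    define q r where "q = n div L" and "r = n mod L"
    have n: "n = q * L + r" by (simp add: q_def r_def)
    have r: "r \<le> L" using L0 by (simp add: r_def less_imp_le)
    have "real (cnt e s n) - real n * \<eta> s
        = real q * (real (cnt e s L) - real L * \<eta> s) + (real (cnt e s r) - real r * \<eta> s)"
      using cnt_periodic[of e L s q r] per by (simp add: n algebra_simps)
    moreover have "\<bar>real q * (real (cnt e s L) - real L * \<eta> s)\<bar> \<le> real q * (\<epsilon> / 2 * real L)"
      unfolding abs_mult abs_of_nat by (intro mult_left_mono order_trans[OF eL[OF s] KL]) simp
    moreover have "\<bar>real (cnt e s r) - real r * \<eta> s\<bar> \<le> r"
    proof -
      have "real r * \<eta> s \<le> real r" "real r * \<eta> s \<ge> 0"
        using \<eta>(1)[OF s] \<eta>1[OF s] by (auto intro: mult_left_le)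
      then show ?thesis using cnt_le[of e s r] by linarith
    qed
    moreover have "real q * (\<epsilon> / 2 * real L) \<le> \<epsilon> / 2 * real n"
      using assms(4) by (simp add: n algebra_simps)
    ultimately show ?thesis using r by linarith
  qed
  show thesis
  proof
    show "\<forall>i. e i < b" using d(1) by (simp add: e_def)
    have "\<forall>\<^sub>F n in sequentially. real n \<ge> 2 * real L / \<epsilon>"
      using filterlim_real_sequentially by (simp add: filterlim_at_top)
    then show "\<forall>\<^sub>F n in sequentially. \<forall>s\<in>?S. \<bar>real (cnt e s n) - real n * \<eta> s\<bar> \<le> \<epsilon> * real n"
    proof eventually_elim
      case (elim n)
      then have "real L + \<epsilon> / 2 * real n \<le> \<epsilon> * real n" using assms(4) by (simp add: field_simps)
      then show ?case using bound[of _ n] by (smt (verit))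
    qed
  qed
qed

text \<open>Delaying a good sequence by \<open>M\<close> foreign digits changes each count by at
  most \<open>M\<close>; half of \<open>\<epsilon>\<close> is reserved for this.\<close>

lemma Delta_frequencies_prefix:
  assumes "b > 0" "k > 0" "\<eta> \<in> Delta b k" "\<epsilon> > 0" "\<And>i. g i < b"
  obtains d where "\<forall>i. d i < b" "\<forall>i<M. d i = g i"
    "\<forall>\<^sub>F n in sequentially. \<forall>s\<in>strings b k. \<bar>real (cnt d s n) - real n * \<eta> s\<bar> \<le> \<epsilon> * real n"
proof -
  have "\<epsilon> / 2 > 0" using assms(4) by simp
  then obtain d where d: "\<forall>i. d i < b"
    "\<forall>\<^sub>F n in sequentially. \<forall>s\<in>strings b k. \<bar>real (cnt d s n) - real n * \<eta> s\<bar> \<le> \<epsilon> / 2 * real n"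
    by (rule Delta_frequencies[OF assms(1-3)]) (rule that)
  define e where "e i = (if i < M then g i else d (i - M))" for i
  have e: "\<bar>real (cnt e s n) - real (cnt d s n)\<bar> \<le> real M" if nM: "n \<ge> M" for s n
  proof -
    obtain l where n: "n = M + l" using le_Suc_ex[OF nM] by blast
    have "cnt e s n = cnt e s M + cnt d s l"
      by (simp add: n cnt_add e_def)
    moreover have "cnt d s n = cnt d s l + cnt (\<lambda>i. d (l + i)) s M"
      by (simp add: n cnt_add add.commute[of M])
    ultimately show ?thesis using cnt_le[of e s M] cnt_le[of "\<lambda>i. d (l + i)" s M] by linarith
  qed
  show thesis
  proof
    show "\<forall>i. e i < b" using d(1) assms(5) by (simp add: e_def)
    show "\<forall>i<M. e i = g i" by (simp add: e_def)
    have "\<forall>\<^sub>F n in sequentially. real n \<ge> 2 * real M / \<epsilon>"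
      using filterlim_real_sequentially by (simp add: filterlim_at_top)
    then show "\<forall>\<^sub>F n in sequentially. \<forall>s\<in>strings b k. \<bar>real (cnt e s n) - real n * \<eta> s\<bar> \<le> \<epsilon> * real n"
      using d(2) eventually_ge_at_top[of M]
    proof eventually_elim
      case (elim n)
      then have "real M \<le> \<epsilon> / 2 * real n" using assms(4) by (simp add: field_simps)
      then have M: "real M + \<epsilon> / 2 * real n \<le> \<epsilon> * real n" by (simp add: algebra_simps)
      show ?case
      proof
        fix s assume "s \<in> strings b k"
        with elim(2) have "\<bar>real (cnt d s n) - real n * \<eta> s\<bar> \<le> \<epsilon> / 2 * real n" by blast
        then show "\<bar>real (cnt e s n) - real n * \<eta> s\<bar> \<le> \<epsilon> * real n"
          using e[OF elim(3), of s] M by linarith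
      qed
    qed
  qed
qed

section \<open>Regular matrices\<close>

text \<open>An Abel-Dini argument. If the partial sums \<open>S\<close> of the absolute values
  diverge, the multipliers \<open>sgn (u i) / (1 + S (Suc i))\<close> tend to 0, yet the resulting
  series is not Cauchy: it gains at least 1/2 between \<open>N\<close> and any \<open>n\<close> with
  \<open>S n > 2 * S N + 1\<close>. For regular matrices this yields absolute summability of the
  rows.\<close>

lemma summable_abs_if_null_multipliers:
  fixes u :: "nat \<Rightarrow> real"
  assumes "\<And>z. z \<longlonglongrightarrow> 0 \<Longrightarrow> summable (\<lambda>i. u i * z i)"
  shows "summable (\<lambda>i. \<bar>u i\<bar>)"
proof (rule ccontr)
  assume ns: "\<not> summable (\<lambda>i. \<bar>u i\<bar>)"
  define S where "S n = (\<Sum>i<n. \<bar>u i\<bar>)" for n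
  have mono: "S m \<le> S n" if "m \<le> n" for m n
    unfolding S_def using that by (intro sum_mono2) auto
  have S0: "S n \<ge> 0" for n by (simp add: S_def sum_nonneg)
  have "\<exists>n. S n > x" for x
  proof (rule ccontr)
    assume "\<nexists>n. S n > x"
    then have "S (Suc n) \<le> x" for n by (auto simp: not_less)
    then have "(\<Sum>i\<le>n. \<bar>u i\<bar>) \<le> x" for n by (simp only: S_def lessThan_Suc_atMost)
    then have "summable (\<lambda>i. \<bar>u i\<bar>)" by (intro bounded_imp_summable[where B = x]) auto
    with ns show False by contradiction
  qed
  then have unb: "\<exists>n\<ge>N. S n > x" for x N
    using mono by (metis less_le_trans linorder_le_cases)
  have top: "filterlim S at_top sequentially"
    unfolding filterlim_at_top eventually_sequentially using unb mono by (meson less_imp_le less_le_trans order_trans)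
  define z where "z i = sgn (u i) / (1 + S (Suc i))" for i
  have "z \<longlonglongrightarrow> 0"
  proof (rule tendsto_rabs_zero_cancel, rule tendsto_sandwich[of "\<lambda>_. 0"])
    have "filterlim (\<lambda>i. 1 + S (Suc i)) at_top sequentially"
      using filterlim_compose[OF top filterlim_Suc] by (rule filterlim_at_top_mono) simp
    then show "(\<lambda>i. inverse (1 + S (Suc i))) \<longlonglongrightarrow> 0"
      by (intro tendsto_inverse_0_at_top)
    show "\<forall>\<^sub>F i in sequentially. \<bar>z i\<bar> \<le> inverse (1 + S (Suc i))"
      using S0 by (auto simp: z_def sgn_if divide_inverse abs_mult)
  qed auto
  from assms[OF this] have "summable (\<lambda>i. u i * z i)" .
  then obtain N where N: "\<And>m n. m \<ge> N \<Longrightarrow> \<bar>\<Sum>i\<in>{m..<n}. u i * z i\<bar> < 1 / 2"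
    unfolding summable_Cauchy by (metis half_gt_zero_iff real_norm_def zero_less_one)
  obtain n where n: "n \<ge> N" "S n > 2 * S N + 1" using unb by blast
  have "1 / 2 \<le> (S n - S N) / (1 + S n)" using n S0[of n] by (simp add: field_simps)
  also have "S n - S N = (\<Sum>i\<in>{N..<n}. \<bar>u i\<bar>)"
    using n(1) sum_diff_nat_ivl[of 0 N n "\<lambda>i. \<bar>u i\<bar>"] by (simp add: S_def lessThan_atLeast0)
  also have "\<dots> / (1 + S n) = (\<Sum>i\<in>{N..<n}. \<bar>u i\<bar> / (1 + S n))" by (simp add: sum_divide_distrib)
  also have "\<dots> \<le> (\<Sum>i\<in>{N..<n}. u i * z i)"
  proof (rule sum_mono)
    fix i assume "i \<in> {N..<n}"
    then have "1 + S (Suc i) \<le> 1 + S n" using mono[of "Suc i" n] by simp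
    then have "\<bar>u i\<bar> / (1 + S n) \<le> \<bar>u i\<bar> / (1 + S (Suc i))"
      using S0[of "Suc i"] by (intro divide_left_mono) auto
    also have "\<dots> = u i * z i" by (simp add: z_def abs_sgn)
    finally show "\<bar>u i\<bar> / (1 + S n) \<le> u i * z i" .
  qed
  finally show False using N[of N n] by linarith
qed

lemma regular_matrix_abs_summable:
  "regular_matrix a \<Longrightarrow> summable (\<lambda>i. \<bar>a n i\<bar>)"
  by (rule summable_abs_if_null_multipliers) (auto simp: regular_matrix_def)

lemma summable_mult_bounded:
  fixes u z :: "nat \<Rightarrow> real"
  assumes "summable (\<lambda>i. \<bar>u i\<bar>)" "\<And>i. \<bar>z i\<bar> \<le> B"
  shows "summable (\<lambda>i. u i * z i)" "\<bar>\<Sum>i. u i * z i\<bar> \<le> B * (\<Sum>i. \<bar>u i\<bar>)"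
proof -
  have le: "norm (u i * z i) \<le> B * \<bar>u i\<bar>" for i
    using mult_left_mono[OF assms(2)[of i], of "\<bar>u i\<bar>"] by (simp add: abs_mult mult.commute)
  have sB: "summable (\<lambda>i. B * \<bar>u i\<bar>)" using assms(1) by (rule summable_mult)
  show "summable (\<lambda>i. u i * z i)" by (rule summable_comparison_test'[OF sB, of 0]) (rule le)
  have sn: "summable (\<lambda>i. norm (u i * z i))"
    by (rule summable_comparison_test'[OF sB, of 0]) (use le in simp)
  have "\<bar>\<Sum>i. u i * z i\<bar> \<le> (\<Sum>i. norm (u i * z i))" using summable_norm[OF sn] by simp
  also have "\<dots> \<le> (\<Sum>i. B * \<bar>u i\<bar>)" by (rule suminf_le[OF le sn sB])
  also have "\<dots> = B * (\<Sum>i. \<bar>u i\<bar>)" using assms(1) by (rule suminf_mult)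
  finally show "\<bar>\<Sum>i. u i * z i\<bar> \<le> B * (\<Sum>i. \<bar>u i\<bar>)" .
qed

text \<open>Beyond \<open>M\<close> the absolute values of \<open>u\<close> sum to less than
  \<open>\<delta> / 2\<close>, while the two sequences differ by at most 2 there. The bound
  \<open>M\<close> serves all pairs of sequences at once.\<close>

lemma transform_finite_dependence:
  fixes u :: "nat \<Rightarrow> real"
  assumes u: "summable (\<lambda>i. \<bar>u i\<bar>)" and "\<delta> > 0"
  obtains M where "\<And>z z'. (\<And>i. \<bar>z i\<bar> \<le> 1) \<Longrightarrow> (\<And>i. \<bar>z' i\<bar> \<le> 1) \<Longrightarrow> (\<And>i. i < M \<Longrightarrow> z i = z' i) \<Longrightarrow>
    \<bar>(\<Sum>i. u i * z i) - (\<Sum>i. u i * z' i)\<bar> < \<delta>"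
proof -
  obtain M where "norm (\<Sum>i. \<bar>u (i + M)\<bar>) < \<delta> / 2"
    using suminf_exist_split[OF half_gt_zero[OF \<open>\<delta> > 0\<close>] u] by blast
  then have M: "(\<Sum>i. \<bar>u (i + M)\<bar>) < \<delta> / 2" unfolding real_norm_def by linarith
  show thesis
  proof
    fix z z' :: "nat \<Rightarrow> real"
    assume z: "\<And>i. \<bar>z i\<bar> \<le> 1" "\<And>i. \<bar>z' i\<bar> \<le> 1" "\<And>i. i < M \<Longrightarrow> z i = z' i"
    have w: "\<bar>z i - z' i\<bar> \<le> 2" for i using z(1,2)[of i] by linarith
    have sM: "summable (\<lambda>i. \<bar>u (i + M)\<bar>)" using u by (simp add: summable_iff_shift[of "\<lambda>i. \<bar>u i\<bar>"])
    have s: "summable (\<lambda>i. u i * (z i - z' i))" using summable_mult_bounded(1)[OF u w] .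
    have "(\<Sum>i. u i * z i) - (\<Sum>i. u i * z' i) = (\<Sum>i. u i * (z i - z' i))"
      using summable_mult_bounded(1)[OF u z(1)] summable_mult_bounded(1)[OF u z(2)]
      by (simp add: suminf_diff right_diff_distrib)
    also have "\<dots> = (\<Sum>i. u (i + M) * (z (i + M) - z' (i + M)))"
      using suminf_split_initial_segment[OF s, of M] z(3) by simp
    also have "\<bar>\<dots>\<bar> \<le> 2 * (\<Sum>i. \<bar>u (i + M)\<bar>)" by (rule summable_mult_bounded(2)[OF sM w])
    finally show "\<bar>(\<Sum>i. u i * z i) - (\<Sum>i. u i * z' i)\<bar> < \<delta>" using M by linarith
  qed
qed

text \<open>The sequence is split into a convergent part, handled by regularity, and a remainder
  bounded by \<open>\<epsilon>\<close>, which contributes at most \<open>\<epsilon>\<close> times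
  the absolute row sum; these sums tend to 1.\<close>

lemma regular_matrix_nearly_convergent:
  assumes reg: "regular_matrix a" and lim: "(\<lambda>n. \<Sum>i. \<bar>a n i\<bar>) \<longlonglongrightarrow> 1"
    and "\<epsilon> > 0" and near: "\<forall>\<^sub>F i in sequentially. \<bar>z i - \<eta>\<bar> \<le> \<epsilon>"
  shows "\<forall>\<^sub>F n in sequentially. \<bar>(\<Sum>i. a n i * z i) - \<eta>\<bar> < 2 * \<epsilon>"
proof -
  have abs: "summable (\<lambda>i. \<bar>a n i\<bar>)" for n using regular_matrix_abs_summable[OF reg] .
  \<comment> \<open>Clamping bounds \<open>y\<close> everywhere, and eventually it changes nothing,
    so \<open>z - y\<close> is eventually equal to \<open>\<eta>\<close>.\<close>
  define y where "y i = max (- \<epsilon>) (min \<epsilon> (z i - \<eta>))" for i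
  have y: "\<bar>y i\<bar> \<le> \<epsilon>" for i using \<open>\<epsilon> > 0\<close> by (auto simp: y_def)
  have "(\<lambda>i. z i - y i) \<longlonglongrightarrow> \<eta>"
    using near by (intro tendsto_eventually) (auto elim!: eventually_mono simp: y_def)
  then have s: "summable (\<lambda>i. a n i * (z i - y i))" and c: "(\<lambda>n. \<Sum>i. a n i * (z i - y i)) \<longlonglongrightarrow> \<eta>" for n
    using reg by (auto simp: regular_matrix_def)
  have "(\<lambda>n. \<bar>(\<Sum>i. a n i * (z i - y i)) - \<eta>\<bar> + \<epsilon> * (\<Sum>i. \<bar>a n i\<bar>)) \<longlonglongrightarrow> \<bar>\<eta> - \<eta>\<bar> + \<epsilon> * 1"
    by (intro tendsto_intros c lim)
  then have "\<forall>\<^sub>F n in sequentially. \<bar>(\<Sum>i. a n i * (z i - y i)) - \<eta>\<bar> + \<epsilon> * (\<Sum>i. \<bar>a n i\<bar>) < 2 * \<epsilon>"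
    by (rule order_tendstoD) (use \<open>\<epsilon> > 0\<close> in simp)
  then show ?thesis
  proof eventually_elim
    case (elim n)
    have "(\<Sum>i. a n i * z i) = (\<Sum>i. a n i * (z i - y i)) + (\<Sum>i. a n i * y i)"
      using suminf_add[OF s[of n] summable_mult_bounded(1)[OF abs[of n] y]] by (simp add: right_diff_distrib)
    with elim summable_mult_bounded(2)[OF abs[of n], of y, OF y] show ?case by linarith
  qed
qed

section \<open>Digits and cylinders\<close>

definition prefix_val :: "nat \<Rightarrow> (nat \<Rightarrow> nat) \<Rightarrow> nat \<Rightarrow> nat" where
  "prefix_val b g n = (\<Sum>i<n. g i * b ^ (n - Suc i))"

text \<open>The ceiling minus one, rather than the floor, places \<open>x\<close> in an interval
  open on the left and closed on the right, which is what selects the nonterminating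
  expansion.\<close>

definition prefix_num :: "nat \<Rightarrow> real \<Rightarrow> nat \<Rightarrow> nat" where
  "prefix_num b x n = nat (\<lceil>real b ^ n * x\<rceil> - 1)"

lemma prefix_val_0 [simp]: "prefix_val b g 0 = 0"
  by (simp add: prefix_val_def)

lemma prefix_val_Suc [simp]: "prefix_val b g (Suc n) = b * prefix_val b g n + g n"
proof -
  have "(\<Sum>i<n. g i * b ^ (Suc n - Suc i)) = (\<Sum>i<n. b * (g i * b ^ (n - Suc i)))"
    by (intro sum.cong refl) (auto simp: Suc_diff_Suc simp flip: power_Suc)
  then show ?thesis by (simp add: prefix_val_def sum_distrib_left)
qed

lemma prefix_val_cong: "(\<And>i. i < n \<Longrightarrow> g i = h i) \<Longrightarrow> prefix_val b g n = prefix_val b h n"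
  by (simp add: prefix_val_def)

lemma partial_sum_eq_prefix_val:
  assumes "b > 0"
  shows "(\<Sum>i<n. real (g i) / real b ^ Suc i) = real (prefix_val b g n) / real b ^ n"
  using assms by (induction n) (auto simp: field_simps)

lemma prefix_val_le:
  assumes "\<And>i. g i < b" "n \<le> m"
  shows "prefix_val b g m + 1 \<le> (prefix_val b g n + 1) * b ^ (m - n)"
  using assms(2)
proof (induction m rule: dec_induct)
  case (step m)
  have "prefix_val b g (Suc m) + 1 \<le> b * (prefix_val b g m + 1)"
    using assms(1)[of m] by simp
  also have "\<dots> \<le> b * ((prefix_val b g n + 1) * b ^ (m - n))"
    using step.IH by (rule mult_le_mono2)
  finally show ?case using step.hyps by (simp add: Suc_diff_le mult_ac)
qed simp

lemma prefix_val_less: "(\<And>i. g i < b) \<Longrightarrow> prefix_val b g n < b ^ n"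
  using prefix_val_le[of g b 0 n] by simp

lemma prefix_num_bounds:
  assumes "b > 0" "x > 0"
  shows "real (prefix_num b x n) < real b ^ n * x" "real b ^ n * x \<le> real (prefix_num b x n) + 1"
proof -
  have "real b ^ n * x > 0" using assms by simp
  then have "\<lceil>real b ^ n * x\<rceil> \<ge> 1" by linarith
  then have "real (prefix_num b x n) = of_int \<lceil>real b ^ n * x\<rceil> - 1"
    by (simp add: prefix_num_def)
  then show "real (prefix_num b x n) < real b ^ n * x" "real b ^ n * x \<le> real (prefix_num b x n) + 1"
    by linarith+
qed

lemma prefix_num_unique:
  assumes "real t < real b ^ n * x" "real b ^ n * x \<le> real t + 1"
  shows "prefix_num b x n = t"
proof -
  have "\<lceil>real b ^ n * x\<rceil> = int t + 1" using assms by (intro ceiling_unique) auto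
  then show ?thesis by (simp add: prefix_num_def)
qed

lemma prefix_num_0: "0 < x \<Longrightarrow> x \<le> 1 \<Longrightarrow> prefix_num b x 0 = 0"
  by (rule prefix_num_unique) auto

lemma prefix_num_Suc_div:
  assumes "b > 0" "x > 0"
  shows "prefix_num b x (Suc n) div b = prefix_num b x n"
proof (rule prefix_num_unique[symmetric])
  define q where "q = prefix_num b x (Suc n)"
  have q: "real q < real b * (real b ^ n * x)" "real b * (real b ^ n * x) \<le> real q + 1"
    using prefix_num_bounds[OF assms, of "Suc n"] by (simp_all add: q_def)
  have "b * (q div b) \<le> q" by simp
  then have "real b * real (q div b) \<le> real q" by (metis of_nat_le_iff of_nat_mult)
  then have "real b * real (q div b) < real b * (real b ^ n * x)" using q by linarith
  then show "real (prefix_num b x (Suc n) div b) < real b ^ n * x"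
    using assms(1) by (simp add: q_def)
  have "q + 1 \<le> b * (q div b + 1)"
    using mod_less_divisor[OF assms(1), of q] mult_div_mod_eq[of b q]
    unfolding distrib_left mult_1_right by linarith
  then have "real q + 1 \<le> real b * (real (q div b) + 1)"
    by (metis of_nat_1 of_nat_add of_nat_le_iff of_nat_mult)
  then have "real b * (real b ^ n * x) \<le> real b * (real (q div b) + 1)" using q by linarith
  then show "real b ^ n * x \<le> real (prefix_num b x (Suc n) div b) + 1"
    using assms(1) by (simp add: q_def)
qed

lemma prefix_num_Suc:
  assumes "b > 0" "x > 0"
  shows "prefix_num b x (Suc n) = b * prefix_num b x n + prefix_num b x (Suc n) mod b"
  using mult_div_mod_eq[of b "prefix_num b x (Suc n)"] prefix_num_Suc_div[OF assms] by simp

lemma prefix_val_prefix_num: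
  assumes "b > 0" "0 < x" "x \<le> 1"
  shows "prefix_val b (\<lambda>i. prefix_num b x (Suc i) mod b) n = prefix_num b x n"
proof (induction n)
  case 0
  then show ?case using assms by (simp add: prefix_num_0)
next
  case (Suc n)
  then show ?case using prefix_num_Suc[of b x n] assms by simp
qed

text \<open>The digits from position \<open>n\<close> on add at most one unit of
  \<open>b\<close>-adic level \<open>n\<close>, attained when all of them are \<open>b - 1\<close>,
  and they add something positive because infinitely many are nonzero. This gives the closed upper
  and the strict lower bound.\<close>

lemma expansion_imp_prefix_num:
  assumes "b \<ge> 2" "\<And>i. g i < b" "(\<lambda>n. real (g n) / real b ^ Suc n) sums x"
    and inf: "\<And>m. \<exists>n\<ge>m. g n \<noteq> 0"
  shows "prefix_num b x n = prefix_val b g n"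
proof (rule prefix_num_unique)
  have b: "b > 0" "real b > 0" using assms(1) by auto
  let ?f = "\<lambda>n. real (prefix_val b g n) / real b ^ n"
  have lim: "?f \<longlonglongrightarrow> x"
    using assms(3) unfolding sums_def partial_sum_eq_prefix_val[OF b(1)] .
  have mono: "?f m \<le> ?f n" if "m \<le> n" for m n
    unfolding partial_sum_eq_prefix_val[OF b(1), symmetric] using that by (intro sum_mono2) auto
  have "?f m \<le> (real (prefix_val b g n) + 1) / real b ^ n" if "n \<le> m" for m
  proof -
    have "real (prefix_val b g m + 1) \<le> real ((prefix_val b g n + 1) * b ^ (m - n))"
      using prefix_val_le[OF assms(2) that] by (simp only: of_nat_le_iff)
    moreover have "real b ^ m = real b ^ (m - n) * real b ^ n" using that by (simp flip: power_add)
    ultimately show ?thesis using b by (simp add: field_simps)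
  qed
  then have "x \<le> (real (prefix_val b g n) + 1) / real b ^ n"
    by (intro LIMSEQ_le_const2[OF lim]) blast
  then show "real b ^ n * x \<le> real (prefix_val b g n) + 1" using b by (simp add: field_simps)
  obtain m where m: "m \<ge> n" "g m \<noteq> 0" using inf by blast
  have "?f n \<le> ?f m" using mono m(1) .
  also have "?f m < ?f (Suc m)" using m(2) b by (simp add: field_simps)
  also have "\<dots> \<le> x" using mono by (intro LIMSEQ_le_const[OF lim]) blast
  finally show "real (prefix_val b g n) < real b ^ n * x" using b by (simp add: field_simps)
qed

text \<open>The residues of \<open>prefix_num\<close> form an expansion of \<open>x\<close>. It
  cannot end in zeros, as \<open>x\<close> would then equal a partial sum, and all partial sums are
  strictly below \<open>x\<close>. Uniqueness follows from
  \<open>expansion_imp_prefix_num\<close>.\<close>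

lemma digit_eq:
  assumes "b \<ge> 2" "0 < x" "x \<le> 1"
  shows "digit b x (Suc n) = prefix_num b x (Suc n) mod b"
proof -
  let ?d = "\<lambda>n. if n = 0 then 0 else prefix_num b x n mod b"
  have b: "b > 0" "real b > 0" using assms(1) by auto
  let ?f = "\<lambda>n. real (prefix_num b x n) / real b ^ n"
  have part: "(\<Sum>i<n. real (?d (Suc i)) / real b ^ Suc i) = ?f n" for n
    using partial_sum_eq_prefix_val[OF b(1), of "\<lambda>i. prefix_num b x (Suc i) mod b" n]
    by (simp add: prefix_val_prefix_num assms b)
  have up: "?f n < x" for n using prefix_num_bounds[of b x n] assms b by (simp add: field_simps)
  have lim: "?f \<longlonglongrightarrow> x"
  proof (rule tendsto_sandwich)
    have "(\<lambda>n. x - (1 / real b) ^ n) \<longlonglongrightarrow> x - 0"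
      using assms(1) by (intro tendsto_intros LIMSEQ_power_zero) simp
    then show "(\<lambda>n. x - (1 / real b) ^ n) \<longlonglongrightarrow> x" by simp
    have "x - (1 / real b) ^ n \<le> ?f n" for n
    proof -
      have "x \<le> (real (prefix_num b x n) + 1) / real b ^ n"
        using prefix_num_bounds(2)[OF b(1) assms(2), of n] b by (simp add: pos_le_divide_eq mult.commute)
      then show ?thesis by (simp add: power_one_over add_divide_distrib)
    qed
    then show "\<forall>\<^sub>F n in sequentially. x - (1 / real b) ^ n \<le> ?f n" by simp
    show "\<forall>\<^sub>F n in sequentially. ?f n \<le> x" using up by (simp add: less_imp_le)
  qed simp
  have "digit b x = ?d"
    unfolding digit_def
  proof (rule the_equality)
    have "\<exists>n>m. ?d n \<noteq> 0" for m
    proof (rule ccontr)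
      assume "\<not> (\<exists>n>m. ?d n \<noteq> 0)"
      then have z: "prefix_num b x n mod b = 0" if "n > m" for n using that by auto
      have "?f (m + l) = ?f m" for l
      proof (induction l)
        case (Suc l)
        have "prefix_num b x (Suc (m + l)) = b * prefix_num b x (m + l)"
          using prefix_num_Suc[OF b(1) assms(2), of "m + l"] z[of "Suc (m + l)"] by linarith
        then have "?f (Suc (m + l)) = ?f (m + l)" using b by simp
        with Suc show ?case by simp
      qed simp
      then have "(\<lambda>l. ?f (l + m)) = (\<lambda>l. ?f m)" by (simp add: add.commute)
      then have "x = ?f m" using LIMSEQ_ignore_initial_segment[OF lim, of m] LIMSEQ_unique by fastforce
      with up[of m] show False by simp
    qed
    then show "?d 0 = 0 \<and> (\<forall>n. ?d n < b) \<and> (\<lambda>n. real (?d (Suc n)) / real b ^ Suc n) sums x \<and> (\<forall>m. \<exists>n>m. ?d n \<noteq> 0)"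
      using lim b unfolding sums_def part by simp
  next
    fix d assume d: "d 0 = 0 \<and> (\<forall>n. d n < b) \<and> (\<lambda>n. real (d (Suc n)) / real b ^ Suc n) sums x \<and> (\<forall>m. \<exists>n>m. d n \<noteq> 0)"
    have "\<exists>n\<ge>m. d (Suc n) \<noteq> 0" for m
    proof -
      obtain n where "n > m" "d n \<noteq> 0" using d by blast
      then show ?thesis by (cases n) (auto simp: less_Suc_eq_le)
    qed
    with d have v: "prefix_num b x n = prefix_val b (\<lambda>i. d (Suc i)) n" for n
      by (intro expansion_imp_prefix_num assms(1)) auto
    show "d = ?d"
    proof
      fix n show "d n = ?d n" using d by (cases n) (auto simp: v)
    qed
  qed
  then show ?thesis by simp
qed

lemma digit_less:
  assumes "b \<ge> 2" "0 < x" "x \<le> 1"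
  shows "digit b x (Suc n) < b"
  using assms by (simp add: digit_eq)

lemma digits_if_prefix_num_eq:
  assumes "b \<ge> 2" "0 < x" "x \<le> 1" "\<And>i. e i < b" "prefix_num b x N = prefix_val b e N" "i < N"
  shows "digit b x (Suc i) = e i"
  using assms(5,6)
proof (induction N)
  case (Suc N)
  have *: "prefix_num b x (Suc N) = b * prefix_val b e N + e N" using Suc.prems by simp
  then have "prefix_num b x (Suc N) mod b = e N" using assms(4) by simp
  moreover have "prefix_num b x N = prefix_val b e N"
    using prefix_num_Suc_div[of b x N] assms(1,2,4) by (simp add: *)
  ultimately show ?case
    using Suc.IH Suc.prems(2) by (cases "i = N") (auto simp: digit_eq assms)
qed simp

text \<open>The points with given first \<open>n\<close> digits form a half-open interval; leaving
  out its right endpoint gives a set that is open on the real line.\<close>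

definition cylinder :: "nat \<Rightarrow> (nat \<Rightarrow> nat) \<Rightarrow> nat \<Rightarrow> real set" where
  "cylinder b e n = {real (prefix_val b e n) / real b ^ n <..< (real (prefix_val b e n) + 1) / real b ^ n}"

lemma cylinder_properties:
  assumes "b \<ge> 2" "\<And>i. e i < b"
  shows "open (cylinder b e n)" "cylinder b e n \<noteq> {}" "cylinder b e n \<subseteq> {0<..1}"
    and "x \<in> cylinder b e n \<Longrightarrow> prefix_num b x n = prefix_val b e n"
    and "x \<in> cylinder b e n \<Longrightarrow> i < n \<Longrightarrow> digit b x (Suc i) = e i"
proof -
  have b: "real b ^ n > 0" using assms(1) by simp
  show "open (cylinder b e n)" by (simp add: cylinder_def)
  have "real (prefix_val b e n) / real b ^ n < (real (prefix_val b e n) + 1) / real b ^ n"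
    using b by (intro divide_strict_right_mono) auto
  then show "cylinder b e n \<noteq> {}" unfolding cylinder_def by (metis greaterThanLessThan_empty_iff not_less)
  have "prefix_val b e n + 1 \<le> b ^ n" using prefix_val_less[of e b n] assms(2) by (simp add: Suc_le_eq)
  then have "real (prefix_val b e n) + 1 \<le> real b ^ n"
    by (metis of_nat_1 of_nat_add of_nat_le_iff of_nat_power)
  then have le: "(real (prefix_val b e n) + 1) / real b ^ n \<le> 1" using b by simp
  have ge: "real (prefix_val b e n) / real b ^ n \<ge> 0" by simp
  show sub: "cylinder b e n \<subseteq> {0<..1}"
  proof
    fix y assume "y \<in> cylinder b e n"
    then have "real (prefix_val b e n) / real b ^ n < y" "y < (real (prefix_val b e n) + 1) / real b ^ n"
      by (simp_all add: cylinder_def)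
    with le ge have "0 < y" "y \<le> 1" by linarith+
    then show "y \<in> {0<..1}" by simp
  qed
  show num: "prefix_num b x n = prefix_val b e n" if "x \<in> cylinder b e n" for x
    using that b by (intro prefix_num_unique) (auto simp: cylinder_def field_simps)
  show "digit b x (Suc i) = e i" if "x \<in> cylinder b e n" "i < n"
    using that sub num by (intro digits_if_prefix_num_eq[of b x e n] assms) auto
qed

text \<open>The word \<open>g\<close> consists of the digits of a point \<open>x\<close> of
  \<open>V\<close>. Points that share \<open>N\<close> digits with \<open>x\<close> lie in one
  half-open interval of length \<open>1 / b^N\<close>, which is smaller than the radius of a ball
  around \<open>x\<close> inside \<open>V\<close>.\<close>

lemma open_contains_cylinders:
  assumes "b \<ge> 2" "open V" "V \<inter> {0<..1} \<noteq> {}"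
  obtains g N where "\<forall>i. g i < b"
    "\<forall>e M. (\<forall>i. e i < b) \<longrightarrow> (\<forall>i<N. e i = g i) \<longrightarrow> N \<le> M \<longrightarrow> cylinder b e M \<subseteq> V"
proof -
  obtain x where x: "x \<in> V" "0 < x" "x \<le> 1" using assms(3) by auto
  obtain \<delta> where \<delta>: "\<delta> > 0" "ball x \<delta> \<subseteq> V" using assms(2) x(1) open_contains_ball by blast
  have b: "real b > 1" "b > 0" using assms(1) by auto
  obtain N where "(1 / real b) ^ N < \<delta>"
    using real_arch_pow_inv[OF \<delta>(1), of "1 / real b"] b by auto
  then have N: "1 < \<delta> * real b ^ N" using b by (simp add: field_simps)
  define g where "g i = digit b x (Suc i)" for i
  have gx: "prefix_val b g N = prefix_num b x N"
    using prefix_val_prefix_num[OF b(2) x(2,3), of N] unfolding g_def digit_eq[OF assms(1) x(2,3)] .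
  show thesis
  proof
    show "\<forall>i. g i < b" using digit_less assms(1) x by (simp add: g_def)
    show "\<forall>e M. (\<forall>i. e i < b) \<longrightarrow> (\<forall>i<N. e i = g i) \<longrightarrow> N \<le> M \<longrightarrow> cylinder b e M \<subseteq> V"
    proof (intro allI impI subsetI)
      fix e M y
      assume e: "\<forall>i. e i < b" "\<forall>i<N. e i = g i" "N \<le> M" and y: "y \<in> cylinder b e M"
      have y01: "0 < y" "y \<le> 1" using cylinder_properties(3)[of b e M] assms(1) e(1) y by auto
      have "digit b y (Suc i) = g i" if "i < N" for i
        using cylinder_properties(5)[of b e y M i] assms(1) e y that by simp
      then have "prefix_val b (\<lambda>i. prefix_num b y (Suc i) mod b) N = prefix_val b g N"
        by (intro prefix_val_cong) (simp add: digit_eq[symmetric] assms(1) y01)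
      then have eq: "prefix_num b y N = prefix_num b x N"
        using prefix_val_prefix_num[of b y N] y01 b gx by simp
      have "real b ^ N * \<bar>x - y\<bar> = \<bar>real b ^ N * x - real b ^ N * y\<bar>"
        by (simp add: abs_mult flip: right_diff_distrib)
      also have "\<dots> < 1 + 1 * 0"
        using prefix_num_bounds[of b x N] prefix_num_bounds[of b y N] b x y01 eq by linarith
      also have "\<dots> < real b ^ N * \<delta>" using N by (simp add: mult.commute)
      finally have "\<bar>x - y\<bar> < \<delta>" using b by simp
      then show "y \<in> V" using \<delta>(2) by (auto simp: dist_real_def)
    qed
  qed
qed

section \<open>Residual behaviour of transformed frequencies\<close>

text \<open>Frequencies are attached to a digit sequence instead of a real number, so that
  constructed sequences can be used directly. Index \<open>i\<close> stands for the first
  \<open>i + 1\<close> positions, in line with the column shift of the matrix.\<close>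

definition seq_freq :: "nat \<Rightarrow> nat \<Rightarrow> (nat \<Rightarrow> nat) \<Rightarrow> nat \<Rightarrow> nat list \<Rightarrow> real" where
  "seq_freq b k d i s = (if s \<in> strings b k then real (cnt d s (Suc i)) / real (Suc i) else 0)"

lemma freq_vec_eq_seq_freq:
  "freq_vec b k (Suc i) x = seq_freq b k (\<lambda>j. digit b x (Suc j)) i"
proof -
  have "{j \<in> {1..n}. \<forall>l<length s. digit b x (j + l) = s ! l}
      = Suc ` {j. j < n \<and> window (\<lambda>j. digit b x (Suc j)) (length s) j = s}" for s n
  proof -
    have "j \<in> Suc ` {j. j < n \<and> window (\<lambda>j. digit b x (Suc j)) (length s) j = s}"
      if "j \<in> {1..n}" "\<forall>l<length s. digit b x (j + l) = s ! l" for j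
      using that by (cases j) (auto simp: window_eq_iff)
    then show ?thesis by (auto simp: window_eq_iff)
  qed
  then have "freq b s n x = real (cnt (\<lambda>j. digit b x (Suc j)) s n) / real n" for s n
    by (simp add: freq_def cnt_def card_image)
  then show ?thesis by (simp add: freq_vec_def seq_freq_def fun_eq_iff)
qed

lemma seq_freq_bounds: "0 \<le> seq_freq b k d i s" "seq_freq b k d i s \<le> 1"
proof -
  have "real (cnt d s (Suc i)) \<le> real (Suc i)" using cnt_le[of d s "Suc i"] by (simp only: of_nat_le_iff)
  then show "0 \<le> seq_freq b k d i s" "seq_freq b k d i s \<le> 1"
    by (simp_all add: seq_freq_def)
qed

lemma seq_freq_cong:
  assumes "\<And>j. j < Suc i + k \<Longrightarrow> d j = e j"
  shows "seq_freq b k d i s = seq_freq b k e i s"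
proof (cases "s \<in> strings b k")
  case True
  then have "cnt d s (Suc i) = cnt e s (Suc i)" using assms by (intro cnt_cong) (auto simp: strings_def)
  then show ?thesis by (simp add: seq_freq_def)
qed (simp add: seq_freq_def)

lemma transform_sum:
  assumes "summable (\<lambda>i. \<bar>u i\<bar>)" "\<And>i s. \<bar>z i s\<bar> \<le> (1::real)"
  shows "(\<Sum>s\<in>S. \<Sum>i. u i * z i s) = (\<Sum>i. u i * (\<Sum>s\<in>S. z i s))"
  using summable_mult_bounded(1)[OF assms(1) assms(2)]
  by (subst suminf_sum[symmetric]) (simp_all add: sum_distrib_left)

text \<open>Each constraint of \<Delta> is expressed by a continuous real function whose values
  along the transformed sequence converge, and \<open>ideal_cluster_point_limit\<close> then
  applies.\<close>

lemma cluster_points_subset_Delta: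
  assumes "is_ideal I" and reg: "regular_matrix a" and lim: "(\<lambda>n. \<Sum>i. \<bar>a n i\<bar>) \<longlonglongrightarrow> 1"
    and "k > 0" and d: "\<And>i. d i < b"
  shows "ideal_cluster_points I (mat_transform a (seq_freq b k d)) \<subseteq> Delta b k"
proof
  fix \<eta> assume \<eta>: "\<eta> \<in> ideal_cluster_points I (mat_transform a (seq_freq b k d))"
  let ?A = "mat_transform a (seq_freq b k d)"
  note limit = ideal_cluster_point_limit[OF \<eta> assms(1)]
  obtain m where m: "k = Suc m" using \<open>k > 0\<close> gr0_implies_Suc by blast
  have abs: "summable (\<lambda>i. \<bar>a n i\<bar>)" for n using regular_matrix_abs_summable[OF reg] .
  have bd: "\<bar>seq_freq b k d i s\<bar> \<le> 1" for i s using seq_freq_bounds[of b k d i s] by simp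
  have reg': "(\<lambda>n. \<Sum>i. a n i * z i) \<longlonglongrightarrow> l" if "z \<longlonglongrightarrow> l" for z l
    using reg that by (auto simp: regular_matrix_def)
  have one: "(\<lambda>n. \<Sum>i. a n i) \<longlonglongrightarrow> 1" using reg'[of "\<lambda>_. 1" 1] by simp
  have coord: "continuous_on UNIV (\<lambda>p :: nat list \<Rightarrow> real. p s)" for s
    by (rule continuous_on_product_coordinates)
  have sums: "(\<Sum>s\<in>S. ?A n (h s)) = (\<Sum>i. a n i * (\<Sum>s\<in>S. seq_freq b k d i (h s)))"
    for S :: "'b set" and h n
    unfolding mat_transform_def by (rule transform_sum[OF abs bd])
  have "\<eta> s = 0" if "s \<notin> strings b k" for s
    by (rule limit[OF coord]) (simp add: mat_transform_def seq_freq_def that)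
  moreover have "(\<Sum>s\<in>strings b k. \<eta> s) = 1"
  proof (rule limit)
    show "continuous_on UNIV (\<lambda>p :: nat list \<Rightarrow> real. \<Sum>s\<in>strings b k. p s)"
      by (intro continuous_on_sum coord)
    have "(\<Sum>s\<in>strings b k. seq_freq b k d i s) = 1" for i
    proof -
      have "(\<Sum>s\<in>strings b k. seq_freq b k d i s) = real (\<Sum>s\<in>strings b k. cnt d s (Suc i)) / real (Suc i)"
        by (simp add: seq_freq_def sum_divide_distrib)
      also have "\<dots> = 1" by (simp add: sum_cnt d del: of_nat_sum)
      finally show ?thesis .
    qed
    then show "(\<lambda>n. \<Sum>s\<in>strings b k. ?A n s) \<longlonglongrightarrow> 1"
      using one sums[of _ "\<lambda>s. s"] by simp
  qed
  moreover have "\<eta> s \<ge> 0" for s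
  proof -
    \<comment> \<open>Nonnegativity is restated as an equation so that the limit lemma covers
      it.\<close>
    have "min (\<eta> s) 0 = 0"
    proof (rule limit)
      show "continuous_on UNIV (\<lambda>p :: nat list \<Rightarrow> real. min (p s) 0)"
        by (intro continuous_on_min coord continuous_on_const)
      \<comment> \<open>Half of \<open>a n i - \<bar>a n i\<bar>\<close> is the negative part of the
        entry with its sign. As frequencies lie between 0 and 1, it bounds each term from below, and
        the row sums of this bound tend to \<open>(1 - 1) / 2\<close>.\<close>
      have low: "((\<Sum>i. a n i) - (\<Sum>i. \<bar>a n i\<bar>)) / 2 \<le> ?A n s" for n
      proof -
        have sa: "summable (a n)" using abs by (rule summable_rabs_cancel)
        have "((\<Sum>i. a n i) - (\<Sum>i. \<bar>a n i\<bar>)) / 2 = (\<Sum>i. (a n i - \<bar>a n i\<bar>) / 2)"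
          using suminf_diff[OF sa abs[of n]] suminf_divide[OF summable_diff[OF sa abs[of n]], of 2] by simp
        also have "\<dots> \<le> ?A n s"
          unfolding mat_transform_def
        proof (rule suminf_le)
          show "summable (\<lambda>i. (a n i - \<bar>a n i\<bar>) / 2)"
            by (intro summable_divide summable_diff sa abs)
          show "summable (\<lambda>i. a n i * seq_freq b k d i s)"
            by (rule summable_mult_bounded(1)[OF abs bd])
          fix i
          show "(a n i - \<bar>a n i\<bar>) / 2 \<le> a n i * seq_freq b k d i s"
            using seq_freq_bounds[of b k d i s] mult_left_le[of "seq_freq b k d i s" "\<bar>a n i\<bar>"]
            by (cases "a n i \<ge> 0") auto
        qed
        finally show ?thesis .
      qed
      show "(\<lambda>n. min (?A n s) 0) \<longlonglongrightarrow> 0"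
      proof (rule tendsto_sandwich)
        have "(\<lambda>n. min (((\<Sum>i. a n i) - (\<Sum>i. \<bar>a n i\<bar>)) / 2) 0) \<longlonglongrightarrow> min ((1 - 1) / 2) 0"
          by (intro tendsto_intros one lim) auto
        then show "(\<lambda>n. min (((\<Sum>i. a n i) - (\<Sum>i. \<bar>a n i\<bar>)) / 2) 0) \<longlonglongrightarrow> 0" by simp
        show "\<forall>\<^sub>F n in sequentially. min (((\<Sum>i. a n i) - (\<Sum>i. \<bar>a n i\<bar>)) / 2) 0 \<le> min (?A n s) 0"
          using low by (intro always_eventually allI min.mono) auto
      qed auto
    qed
    then show ?thesis by linarith
  qed
  moreover have "(\<Sum>c<b. \<eta> (c # s)) = (\<Sum>c<b. \<eta> (s @ [c]))" if s: "s \<in> strings b m" for s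
  proof -
    \<comment> \<open>The flow defect of the frequencies: at most one occurrence divided by
      \<open>i + 1\<close>, hence a null sequence.\<close>
    define z where "z i = (\<Sum>c<b. seq_freq b k d i (c # s)) - (\<Sum>c<b. seq_freq b k d i (s @ [c]))" for i
    have "(\<lambda>i. real 1 / real (Suc i)) \<longlonglongrightarrow> 0" using LIMSEQ_inverse_real_of_nat by (simp add: divide_inverse)
    moreover have "\<bar>z i\<bar> \<le> real 1 / real (Suc i)" for i
    proof -
      have "z i = (real (\<Sum>c<b. cnt d (c # s) (Suc i)) - real (\<Sum>c<b. cnt d (s @ [c]) (Suc i))) / real (Suc i)"
        using s by (simp add: z_def seq_freq_def m Cons_in_strings snoc_in_strings sum_divide_distrib diff_divide_distrib)
      also have "\<dots> = (real (cnt (\<lambda>i. d (1 + i)) s (Suc i)) - real (cnt d s (Suc i))) / real (Suc i)"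
        by (simp only: sum_cnt_Cons[of d, OF d] sum_cnt_snoc[of d, OF d])
      finally have z: "z i = (real (cnt (\<lambda>i. d (1 + i)) s (Suc i)) - real (cnt d s (Suc i))) / real (Suc i)" .
      have "\<bar>real (cnt (\<lambda>i. d (1 + i)) s (Suc i)) - real (cnt d s (Suc i))\<bar> \<le> real 1"
        using cnt_shift_one[of d s "Suc i"] cnt_le[of d s 1] cnt_le[of "\<lambda>j. d (Suc i + j)" s 1] by linarith
      then show ?thesis unfolding z abs_divide by (simp add: divide_right_mono)
    qed
    ultimately have "z \<longlonglongrightarrow> 0"
      by (intro Lim_null_comparison[of z "\<lambda>i. real 1 / real (Suc i)"]) auto
    then have z0: "(\<lambda>n. \<Sum>i. a n i * z i) \<longlonglongrightarrow> 0" and sz: "summable (\<lambda>i. a n i * z i)" for n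
      using reg by (auto simp: regular_matrix_def)
    have "(\<Sum>c<b. \<eta> (c # s)) - (\<Sum>c<b. \<eta> (s @ [c])) = 0"
    proof (rule limit)
      show "continuous_on UNIV (\<lambda>p :: nat list \<Rightarrow> real. (\<Sum>c<b. p (c # s)) - (\<Sum>c<b. p (s @ [c])))"
        by (intro continuous_on_diff continuous_on_sum coord)
      have "(\<Sum>c<b. ?A n (c # s)) - (\<Sum>c<b. ?A n (s @ [c])) = (\<Sum>i. a n i * z i)" for n
      proof -
        have "summable (\<lambda>i. a n i * (\<Sum>c<b. seq_freq b k d i (h c)))" for h
          using summable_mult_bounded(1)[OF abs bd] by (simp add: sum_distrib_left summable_sum)
        then show ?thesis
          unfolding sums z_def by (subst suminf_diff) (auto simp: right_diff_distrib)
      qed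
      then show "(\<lambda>n. (\<Sum>c<b. ?A n (c # s)) - (\<Sum>c<b. ?A n (s @ [c]))) \<longlonglongrightarrow> 0" using z0 by simp
    qed
    then show ?thesis by simp
  qed
  ultimately show "\<eta> \<in> Delta b k" by (simp add: Delta_def m)
qed

text \<open>A basic open set of the product restricts only finitely many coordinates, so one radius
  works for all of them; the 1 in the minimum covers the case of no restricted coordinate.\<close>

lemma open_fun_contains_box:
  fixes U :: "('a \<Rightarrow> real) set"
  assumes "open U" "\<eta> \<in> U"
  obtains \<epsilon> where "\<epsilon> > 0" "\<forall>f. (\<forall>s. \<bar>f s - \<eta> s\<bar> < \<epsilon>) \<longrightarrow> f \<in> U"
proof -
  have "openin (product_topology (\<lambda>_. euclidean) UNIV) U" using assms(1) by (simp add: open_fun_def)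
  from product_topology_open_contains_basis[OF this assms(2)] obtain X where X:
    "\<eta> \<in> PiE UNIV X" "\<And>s. open (X s)" "finite {s. X s \<noteq> UNIV}" "PiE UNIV X \<subseteq> U" by auto
  have "\<exists>r>0. ball (\<eta> s) r \<subseteq> X s" for s
    using X(1,2) open_contains_ball by (metis PiE_mem UNIV_I)
  then obtain r where r: "\<And>s. r s > 0" "\<And>s. ball (\<eta> s) (r s) \<subseteq> X s" by metis
  define \<epsilon> where "\<epsilon> = Min (insert 1 (r ` {s. X s \<noteq> UNIV}))"
  show thesis
  proof
    show "\<epsilon> > 0" using X(3) r(1) by (simp add: \<epsilon>_def)
    show "\<forall>f. (\<forall>s. \<bar>f s - \<eta> s\<bar> < \<epsilon>) \<longrightarrow> f \<in> U"
    proof (intro allI impI)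
      fix f assume f: "\<forall>s. \<bar>f s - \<eta> s\<bar> < \<epsilon>"
      have "f s \<in> X s" for s
      proof (cases "X s = UNIV")
        case False
        then have "\<epsilon> \<le> r s" unfolding \<epsilon>_def using X(3) by (intro Min_le) auto
        then have "f s \<in> ball (\<eta> s) (r s)" using f[rule_format, of s] by (simp add: dist_real_def abs_minus_commute)
        then show ?thesis using r(2) by blast
      qed simp
      then show "f \<in> U" using X(4) by (auto simp: PiE_def Pi_def)
    qed
  qed
qed

text \<open>A block of matrix rows sees only finitely many digits up to a small error, so a digit sequence
  whose block of transformed frequencies is near \<open>\<eta>\<close> has a cylinder on which they all are.\<close>

lemma nowhere_dense_bad_set:
  assumes reg: "regular_matrix a" and lim: "(\<lambda>n. \<Sum>i. \<bar>a n i\<bar>) \<longlonglongrightarrow> 1"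
    and b: "b \<ge> 2" and k: "k > 0" and U: "open U" "\<eta> \<in> U" and \<eta>: "\<eta> \<in> Delta b k" and r: "strict_mono r"
  shows "nowhere_dense_in (subtopology euclideanreal {0<..1})
    {x \<in> {0<..1}. \<not> (\<exists>j\<ge>m. \<forall>n\<in>{r j..<r (Suc j)}. mat_transform a (seq_freq b k (\<lambda>i. digit b x (Suc i))) n \<in> U)}"
    (is "nowhere_dense_in ?X ?S")
proof (rule nowhere_dense_inI)
  show "?S \<subseteq> topspace ?X" by auto
  fix W assume W: "openin ?X W" "W \<noteq> {}"
  then obtain V where V: "open V" "W = V \<inter> {0<..1}" by (auto simp: openin_open)
  have abs: "summable (\<lambda>i. \<bar>a n i\<bar>)" for n using regular_matrix_abs_summable[OF reg] .
  have bd: "\<bar>seq_freq b k d i s\<bar> \<le> 1" for d i s using seq_freq_bounds[of b k d i s] by simp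
  have b0: "b > 0" using b by simp
  obtain g N where g: "\<forall>i. g i < b"
    and cyl: "\<forall>e M. (\<forall>i. e i < b) \<longrightarrow> (\<forall>i<N. e i = g i) \<longrightarrow> N \<le> M \<longrightarrow> cylinder b e M \<subseteq> V"
    by (rule open_contains_cylinders[OF b V(1)]) (use W V in auto)
  obtain \<epsilon>' where \<epsilon>': "\<epsilon>' > 0" and box: "\<forall>f. (\<forall>s. \<bar>f s - \<eta> s\<bar> < \<epsilon>') \<longrightarrow> f \<in> U"
    by (rule open_fun_contains_box[OF U])
  \<comment> \<open>Two thirds go to the transformed frequencies of the constructed sequence
    \<open>e\<close>, one third to the passage from \<open>e\<close> to a point of its
    cylinder.\<close>
  define \<epsilon> where "\<epsilon> = \<epsilon>' / 3"
  have \<epsilon>: "\<epsilon> > 0" using \<epsilon>' by (simp add: \<epsilon>_def)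
  obtain e where e: "\<forall>i. e i < b" "\<forall>i<N. e i = g i"
    and fr: "\<forall>\<^sub>F n in sequentially. \<forall>s\<in>strings b k. \<bar>real (cnt e s n) - real n * \<eta> s\<bar> \<le> \<epsilon> * real n"
    by (rule Delta_frequencies_prefix[OF b0 k \<eta> \<epsilon>, of g N]) (use g in auto)
  have "\<forall>\<^sub>F i in sequentially. \<bar>seq_freq b k e i s - \<eta> s\<bar> \<le> \<epsilon>" if s: "s \<in> strings b k" for s
    using eventually_compose_filterlim[OF fr filterlim_Suc]
  proof eventually_elim
    case (elim i)
    then have "\<bar>real (cnt e s (Suc i)) - real (Suc i) * \<eta> s\<bar> \<le> \<epsilon> * real (Suc i)" using s by blast
    moreover have "seq_freq b k e i s - \<eta> s = (real (cnt e s (Suc i)) - real (Suc i) * \<eta> s) / real (Suc i)"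
      using s by (simp add: seq_freq_def diff_divide_distrib)
    ultimately show ?case by (simp only: abs_divide) (simp add: pos_divide_le_eq)
  qed
  then have "\<forall>\<^sub>F n in sequentially. \<bar>mat_transform a (seq_freq b k e) n s - \<eta> s\<bar> < 2 * \<epsilon>" if "s \<in> strings b k" for s
    unfolding mat_transform_def using that by (intro regular_matrix_nearly_convergent[OF reg lim \<epsilon>])
  then have "\<forall>\<^sub>F n in sequentially. \<forall>s\<in>strings b k. \<bar>mat_transform a (seq_freq b k e) n s - \<eta> s\<bar> < 2 * \<epsilon>"
    by (intro eventually_ball_finite) auto
  then obtain n0 where n0: "\<And>n s. n \<ge> n0 \<Longrightarrow> s \<in> strings b k \<Longrightarrow> \<bar>mat_transform a (seq_freq b k e) n s - \<eta> s\<bar> < 2 * \<epsilon>"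
    by (auto simp: eventually_sequentially)
  define j where "j = max m n0"
  have rj: "r j \<ge> n0" using strict_mono_imp_increasing[OF r, of j] by (simp add: j_def)
  have "\<exists>M. \<forall>z z'. (\<forall>i. \<bar>z i\<bar> \<le> 1) \<longrightarrow> (\<forall>i. \<bar>z' i\<bar> \<le> 1) \<longrightarrow> (\<forall>i<M. z i = z' i) \<longrightarrow>
      \<bar>(\<Sum>i. a n i * z i) - (\<Sum>i. a n i * z' i)\<bar> < \<epsilon>" for n
    by (rule transform_finite_dependence[OF abs \<epsilon>]) blast
  then obtain M where M: "\<And>n z z'. (\<forall>i. \<bar>z i\<bar> \<le> 1) \<Longrightarrow> (\<forall>i. \<bar>z' i\<bar> \<le> 1) \<Longrightarrow> (\<forall>i<M n. z i = z' i) \<Longrightarrow>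
      \<bar>(\<Sum>i. a n i * z i) - (\<Sum>i. a n i * z' i)\<bar> < \<epsilon>" by metis
  \<comment> \<open>\<open>N\<close> keeps the cylinder inside \<open>V\<close>. The sum exceeds or
    equals every \<open>M n\<close> with \<open>n\<close> in the block, and \<open>k\<close> is
    added because frequency number \<open>i\<close> reads the first \<open>i + k\<close>
    digits.\<close>
  define L where "L = N + k + (\<Sum>n<r (Suc j). M n)"
  have "cylinder b e L \<inter> ?S = {}"
  proof (rule ccontr)
    assume "cylinder b e L \<inter> ?S \<noteq> {}"
    then obtain x where x: "x \<in> cylinder b e L" "x \<in> ?S" by blast
    have dig: "digit b x (Suc i) = e i" if "i < L" for i
      using cylinder_properties(5)[OF b _ x(1) that] e(1) by blast
    have "mat_transform a (seq_freq b k (\<lambda>i. digit b x (Suc i))) n \<in> U" if n: "n \<in> {r j..<r (Suc j)}" for n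
    proof (rule box[rule_format])
      fix s
      show "\<bar>mat_transform a (seq_freq b k (\<lambda>i. digit b x (Suc i))) n s - \<eta> s\<bar> < \<epsilon>'"
      proof (cases "s \<in> strings b k")
        case True
        have "M n \<le> (\<Sum>n<r (Suc j). M n)" using n by (intro member_le_sum) auto
        then have "seq_freq b k (\<lambda>i. digit b x (Suc i)) i s = seq_freq b k e i s" if "i < M n" for i
          using that by (intro seq_freq_cong dig) (simp add: L_def)
        then have "\<bar>mat_transform a (seq_freq b k (\<lambda>i. digit b x (Suc i))) n s - mat_transform a (seq_freq b k e) n s\<bar> < \<epsilon>"
          unfolding mat_transform_def using bd by (intro M) auto
        moreover have "\<bar>mat_transform a (seq_freq b k e) n s - \<eta> s\<bar> < 2 * \<epsilon>"
          using n0[OF _ True] n rj by simp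
        moreover have "\<epsilon>' = 3 * \<epsilon>" by (simp add: \<epsilon>_def)
        ultimately show ?thesis by linarith
      next
        case False
        then show ?thesis using \<eta> \<epsilon>' by (simp add: mat_transform_def seq_freq_def Delta_def)
      qed
    qed
    moreover have "j \<ge> m" by (simp add: j_def)
    ultimately show False using x(2) by blast
  qed
  moreover have "cylinder b e L \<subseteq> V" using cyl e by (simp add: L_def)
  moreover have "open (cylinder b e L)" "cylinder b e L \<noteq> {}" "cylinder b e L \<subseteq> {0<..1}"
    using cylinder_properties(1-3)[OF b, of e L] e(1) by blast+
  ultimately show "\<exists>V. openin ?X V \<and> V \<noteq> {} \<and> V \<subseteq> W \<and> V \<inter> ?S = {}"
    unfolding V(2) by (intro exI[of _ "cylinder b e L"]) (auto simp: openin_open)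
qed

theorem theorem4p7:
  fixes I :: "nat set set" and a :: "nat \<Rightarrow> nat \<Rightarrow> real"
  assumes "meager_ideal I"
    and "regular_matrix a"
    and "(\<lambda>n. \<Sum>i. \<bar>a n i\<bar>) \<longlonglongrightarrow> 1"
  shows "comeager_in (subtopology euclideanreal {0<..1})
           {x \<in> {0<..1}. \<forall>b\<ge>2. \<forall>k\<ge>1. Gamma_set b k x I a = Delta b k}"
proof -
  let ?X = "subtopology euclideanreal {0<..1}"
  let ?G = "{x \<in> {0<..1}. \<forall>b\<ge>2. \<forall>k\<ge>1. Gamma_set b k x I a = Delta b k}"
  let ?A = "\<lambda>b k x. mat_transform a (seq_freq b k (\<lambda>i. digit b x (Suc i)))"
  have ideal: "is_ideal I" using assms(1) by (simp add: meager_ideal_def)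
  have sub: "\<And>A B. A \<in> I \<Longrightarrow> B \<subseteq> A \<Longrightarrow> B \<in> I" using ideal by (auto simp: is_ideal_def)
  obtain r where r: "strict_mono r" "\<And>A. (\<And>m. \<exists>j\<ge>m. {r j..<r (Suc j)} \<subseteq> A) \<Longrightarrow> A \<notin> I"
    by (rule meager_ideal_intervals[OF assms(1)]) blast
  obtain \<B> :: "(nat list \<Rightarrow> real) set set" where \<B>: "countable \<B>" "topological_basis \<B>"
    using ex_countable_basis by blast
  define bad where "bad = (\<lambda>(b, k, m, U).
    {x \<in> {0<..1}. \<not> (\<exists>j\<ge>m. \<forall>n\<in>{r j..<r (Suc j)}. ?A b k x n \<in> U)})"
  \<comment> \<open>Restricting to a countable basis, and to basic sets that meet \<Delta>, leaves
    countably many conditions, each with a nowhere dense set of exceptions.\<close>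
  define Q where "Q = {(b, k, m :: nat, U). b \<ge> 2 \<and> k \<ge> 1 \<and> U \<in> \<B> \<and> U \<inter> Delta b k \<noteq> {}}"
  have Gamma: "Gamma_set b k x I a = ideal_cluster_points I (?A b k x)" for b k x
    by (simp add: Gamma_set_def freq_vec_eq_seq_freq)
  have "topspace ?X - ?G \<subseteq> \<Union> (bad ` Q)"
  proof
    fix x assume "x \<in> topspace ?X - ?G"
    then obtain b k where x: "0 < x" "x \<le> 1" and bk: "b \<ge> 2" "k \<ge> 1"
      and ne: "ideal_cluster_points I (?A b k x) \<noteq> Delta b k"
      by (auto simp: Gamma)
    have "ideal_cluster_points I (?A b k x) \<subseteq> Delta b k"
      using bk digit_less[OF bk(1) x] by (intro cluster_points_subset_Delta[OF ideal assms(2,3)]) auto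
    with ne obtain \<eta> where \<eta>: "\<eta> \<in> Delta b k" "\<eta> \<notin> ideal_cluster_points I (?A b k x)" by blast
    then obtain U' where U': "open U'" "\<eta> \<in> U'" "{n. ?A b k x n \<in> U'} \<in> I"
      by (auto simp: ideal_cluster_points_def)
    obtain U where U: "U \<in> \<B>" "\<eta> \<in> U" "U \<subseteq> U'"
      using topological_basisE[OF \<B>(2) U'(1,2)] by blast
    have "{n. ?A b k x n \<in> U} \<in> I" by (rule sub[OF U'(3)]) (use U(3) in auto)
    \<comment> \<open>A set in the ideal contains no block from some index \<open>m\<close> on, by
      the choice of \<open>r\<close>.\<close>
    then obtain m where m: "\<not> (\<exists>j\<ge>m. {r j..<r (Suc j)} \<subseteq> {n. ?A b k x n \<in> U})" using r(2) by blast
    have "x \<in> bad (b, k, m, U)" using m x by (auto simp: bad_def)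
    moreover have "(b, k, m, U) \<in> Q" using bk U \<eta>(1) by (auto simp: Q_def)
    ultimately show "x \<in> \<Union> (bad ` Q)" by blast
  qed
  moreover have "nowhere_dense_in ?X S" if SQ: "S \<in> bad ` Q" for S
  proof -
    obtain q where q: "q \<in> Q" "S = bad q" using SQ by blast
    obtain b k m U where "q = (b, k, m, U)" by (cases q)
    with q have S: "S = bad (b, k, m, U)" and Q: "b \<ge> 2" "k \<ge> 1" "U \<in> \<B>" "U \<inter> Delta b k \<noteq> {}"
      by (auto simp: Q_def)
    then obtain \<eta> where "\<eta> \<in> U" "\<eta> \<in> Delta b k" by blast
    moreover have "open U" using topological_basis_open[OF \<B>(2) Q(3)] .
    ultimately show ?thesis
      unfolding S bad_def prod.case using Q by (intro nowhere_dense_bad_set[OF assms(2,3) _ _ _ _ _ r(1)]) auto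
  qed
  moreover have "countable (bad ` Q)"
  proof -
    have "Q \<subseteq> UNIV \<times> UNIV \<times> UNIV \<times> \<B>" by (auto simp: Q_def)
    then show ?thesis using \<B>(1) by (intro countable_image) (rule countable_subset, auto)
  qed
  ultimately have "meager_in ?X (topspace ?X - ?G)" by (intro meager_inI_countable)
  then show ?thesis by (auto simp: comeager_in_def)
qed

end
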